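(* Let $A\in\mathcal{K}$ be a Koch type set with $\mathcal{H}^1(\Lambda_\infty^{-1})>0$. Then $A$ is not countably $1$-rectifiable.
   Context: A set $M\subset\mathbb{R}^2$ is countably $1$-rectifiable if $M\subset M_0\cup\bigcup_{j=1}^\infty F_j(\mathbb{R})$ with $\mathcal{H}^1(M_0)=0$ and $F_j:\mathbb{R}\to\mathbb{R}^2$ Lipschitz. A triangular cap on a segment is a closed solid isosceles triangle having that segment as base; its base angle is either of its two equal angles. Koch type sets: let $A_{0,1}\subset\mathbb{R}^2$ be a segment of finite positive length, and $T_{0,1}$ a triangular cap on it of height $\varepsilon\mathcal{H}^1(A_{0,1})$ with $0<\varepsilon<1/100$ and base angle $\theta_{0,1}$. Inductively, given caps $T_{n,i}$ on segments $A_{n,i}$ with base angles $\theta_{n,i}$ ($1\le i\le2^n$), let $A_{n+1,2i-1},A_{n+1,2i}$ be the two edges of $T_{n,i}$ other than its base, numbered so that $A_{n+1,1},\dots,A_{n+1,2^{n+1}}$ are consecutive segments of a polygonal curve joining the end points of $A_{0,1}$ (always starting from the same end point), and for $k\in\{2i-1,2i\}$ let $T_{n+1,k}\subset T_{n,i}$ be a triangular cap on $A_{n+1,k}$ with base angle $\theta_{n+1,k}\le\theta_{n,i}$. Let $B=\bigcap_{n=0}^\infty\bigcup_{i=1}^{2^n}T_{n,i}$ and let $E(B)$ be the set of all vertices of all $T_{n,i}$. A Koch type set is any set $A\in\{B,B\setminus E(B)\}$ arising in this way; $\mathcal{K}$ is the collection of all of them. Parametrisation: let $D_{n,1},\dots,D_{n,2^n}$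 be the $2^n$ consecutive closed subsegments of $A_{0,1}$ of equal length (numbered from the same end point), and $F_n:A_{0,1}\to\mathbb{R}^2$ the continuous map taking each $D_{n,i}$ affinely onto $A_{n,i}$ in the order-preserving way. The limit $\mathcal{F}=\lim_{n\to\infty}F_n$ exists pointwise and is a bijection of $A_{0,1}$ onto $B$ with $\mathcal{F}(D_{n,i})\subset T_{n,i}$. For $x\in B$ let $i(n,x)$ be the index $i$ with $x\in T_{n,i}$ (the larger one if there are two, which happens only for $x\in E(B)$), and $\tilde\Pi(x)=\prod_{n=0}^\infty(\cos\theta_{n,i(n,x)})^{-1}\in[1,\infty]$. Set $\Lambda_\infty=\{x\in A:\tilde\Pi(x)=\infty\}$ and $\Lambda_\infty^{-1}=\mathcal{F}^{-1}(\Lambda_\infty)\subset A_{0,1}$. *)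

theory Defs
  imports "HOL-Analysis.Analysis"
begin

section \<open>One-dimensional Hausdorff measure and rectifiability\<close>

text \<open>
  The usual (outer) measure, defined on all sets and normalised so that a segment gets its length.
  Boundedness of the covering sets is explicit because \<^const>\<open>diameter\<close> is a real number and
  carries no information for unbounded sets.
\<close>

definition hausdorff1_pre :: "real \<Rightarrow> 'a::metric_space set \<Rightarrow> ennreal" where
  "hausdorff1_pre \<delta> S =
     Inf {(\<Sum>k. ennreal (diameter (C k))) | C :: nat \<Rightarrow> 'a set.
            S \<subseteq> (\<Union>k. C k) \<and> (\<forall>k. bounded (C k) \<and> diameter (C k) \<le> \<delta>)}"

definition hausdorff1 :: "'a::metric_space set \<Rightarrow> ennreal" where
  "hausdorff1 S = (SUP \<delta>\<in>{0<..}. hausdorff1_pre \<delta> S)"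

definition countably_1_rectifiable :: "(real^2) set \<Rightarrow> bool" where
  "countably_1_rectifiable M \<longleftrightarrow>
     (\<exists>M0 (F :: nat \<Rightarrow> real \<Rightarrow> real^2).
        M \<subseteq> M0 \<union> (\<Union>j. range (F j)) \<and> hausdorff1 M0 = 0 \<and>
        (\<forall>j. \<exists>L. L-lipschitz_on UNIV (F j)))"


section \<open>Triangular caps\<close>

text \<open>The unoriented angle at the vertex \<open>a\<close> between the rays towards \<open>b\<close> and \<open>c\<close>.\<close>

definition angle_at :: "'a::real_inner \<Rightarrow> 'a \<Rightarrow> 'a \<Rightarrow> real" where
  "angle_at a b c = arccos (((b - a) \<bullet> (c - a)) / (norm (b - a) * norm (c - a)))"

text \<open>
  A triangular cap on the segment from \<open>a\<close> to \<open>b\<close> is given by its apex \<open>c\<close>. Its base angle is taken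
  at \<open>a\<close>; for an isosceles triangle the angle at \<open>b\<close> is the same.
\<close>

definition is_cap :: "real^2 \<Rightarrow> real^2 \<Rightarrow> real^2 \<Rightarrow> bool" where
  "is_cap a b c \<longleftrightarrow> \<not> collinear {a, b, c} \<and> dist a c = dist b c"

definition cap :: "real^2 \<Rightarrow> real^2 \<Rightarrow> real^2 \<Rightarrow> (real^2) set" where
  "cap a b c = convex hull {a, b, c}"

definition base_angle :: "real^2 \<Rightarrow> real^2 \<Rightarrow> real^2 \<Rightarrow> real" where
  "base_angle a b c = angle_at a b c"

definition cap_height :: "real^2 \<Rightarrow> real^2 \<Rightarrow> real^2 \<Rightarrow> real" where
  "cap_height a b c = infdist c (affine hull {a, b})"


section \<open>Koch type sets\<close>

text \<open>
  A construction is encoded by the vertices of its polygonal curves: \<open>p n 0, \<dots>, p n (2 ^ n)\<close> are the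
  successive vertices of the curve of generation \<open>n\<close>. Indices are shifted by one: for \<open>i < 2 ^ n\<close>,
  the segment \<open>koch_A p n i\<close> and the cap \<open>koch_T p n i\<close> are the usual $A_{n,i+1}$ and $T_{n,i+1}$, and
  the edges of \<open>koch_T p n i\<close> other than its base are the segments of generation \<open>Suc n\<close> with the
  indices \<open>2 * i\<close> and \<open>2 * i + 1\<close>. Thus the apex of \<open>koch_T p n i\<close> is the vertex
  \<open>p (Suc n) (2 * i + 1)\<close>, and old vertices are kept: \<open>p (Suc n) (2 * i) = p n i\<close>.
  All curves start at \<open>p 0 0\<close>.
\<close>

type_synonym koch_vertices = "nat \<Rightarrow> nat \<Rightarrow> real^2"

definition koch_A :: "koch_vertices \<Rightarrow> nat \<Rightarrow> nat \<Rightarrow> (real^2) set" where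
  "koch_A p n i = closed_segment (p n i) (p n (Suc i))"

definition koch_T :: "koch_vertices \<Rightarrow> nat \<Rightarrow> nat \<Rightarrow> (real^2) set" where
  "koch_T p n i = cap (p n i) (p n (Suc i)) (p (Suc n) (2 * i + 1))"

definition koch_angle :: "koch_vertices \<Rightarrow> nat \<Rightarrow> nat \<Rightarrow> real" where
  "koch_angle p n i = base_angle (p n i) (p n (Suc i)) (p (Suc n) (2 * i + 1))"

definition koch_construction :: "koch_vertices \<Rightarrow> bool" where
  "koch_construction p \<longleftrightarrow>
     p 0 0 \<noteq> p 0 1 \<and>
     (\<exists>\<epsilon>>0. \<epsilon> < 1/100 \<and>
        ennreal (cap_height (p 0 0) (p 0 1) (p 1 1)) = ennreal \<epsilon> * hausdorff1 (koch_A p 0 0)) \<and>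
     (\<forall>n. \<forall>i\<le>2^n. p (Suc n) (2 * i) = p n i) \<and>
     (\<forall>n. \<forall>i<2^n. is_cap (p n i) (p n (Suc i)) (p (Suc n) (2 * i + 1))) \<and>
     (\<forall>n. \<forall>i<2^n. \<forall>k\<in>{2 * i, 2 * i + 1}.
        koch_T p (Suc n) k \<subseteq> koch_T p n i \<and> koch_angle p (Suc n) k \<le> koch_angle p n i)"

definition koch_B :: "koch_vertices \<Rightarrow> (real^2) set" where
  "koch_B p = (\<Inter>n. \<Union>i<2^n. koch_T p n i)"

definition koch_E :: "koch_vertices \<Rightarrow> (real^2) set" where
  "koch_E p = (\<Union>n. \<Union>i<2^n. {p n i, p n (Suc i), p (Suc n) (2 * i + 1)})"

definition koch_type_set :: "koch_vertices \<Rightarrow> (real^2) set \<Rightarrow> bool" where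
  "koch_type_set p A \<longleftrightarrow> koch_construction p \<and> A \<in> {koch_B p, koch_B p - koch_E p}"


section \<open>The parametrisation and the set of infinite product\<close>

text \<open>
  \<open>koch_d p n i\<close> are the division points of the initial segment into \<open>2 ^ n\<close> equal parts, so
  that part number \<open>i\<close> is \<open>closed_segment (koch_d p n i) (koch_d p n (Suc i))\<close>.
  In \<open>koch_F\<close>, \<open>t\<close> is the position of \<open>x\<close> on the initial segment, scaled to $[0, 2^n]$; the \<open>min\<close>
  puts the end point into the last part. That this is the map which takes part number \<open>i\<close>
  affinely onto \<open>koch_A p n i\<close> is shown in \<open>koch_F_affine\<close>.
\<close>

definition koch_d :: "koch_vertices \<Rightarrow> nat \<Rightarrow> nat \<Rightarrow> real^2" where
  "koch_d p n i = p 0 0 + (real i / 2^n) *\<^sub>R (p 0 1 - p 0 0)"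

definition koch_F :: "koch_vertices \<Rightarrow> nat \<Rightarrow> real^2 \<Rightarrow> real^2" where
  "koch_F p n x =
     (let t = 2^n * (dist (p 0 0) x / dist (p 0 0) (p 0 1));
          i = min (nat \<lfloor>t\<rfloor>) (2^n - 1)
      in p n i + (t - real i) *\<^sub>R (p n (Suc i) - p n i))"

lemma koch_F_affine:
  assumes "p 0 0 \<noteq> p 0 1" "i < 2^n" "0 \<le> s" "s \<le> 1"
  shows "koch_F p n ((1 - s) *\<^sub>R koch_d p n i + s *\<^sub>R koch_d p n (Suc i))
           = (1 - s) *\<^sub>R p n i + s *\<^sub>R p n (Suc i)"
proof -
  let ?x = "(1 - s) *\<^sub>R koch_d p n i + s *\<^sub>R koch_d p n (Suc i)"
  let ?v = "p 0 1 - p 0 0"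
  define r where "r = (real i + s) / 2^n"
  have "(1 - s) * (real i / 2^n) + s * (real (Suc i) / 2^n) = r"
    by (simp add: r_def field_simps)
  moreover have "?x = p 0 0 + ((1 - s) * (real i / 2^n) + s * (real (Suc i) / 2^n)) *\<^sub>R ?v"
    by (simp only: koch_d_def scaleR_add_right scaleR_add_left scaleR_scaleR)
       (simp add: scaleR_left_diff_distrib)
  ultimately have x: "?x = p 0 0 + r *\<^sub>R ?v"
    by simp
  have "r \<ge> 0"
    using assms by (simp add: r_def)
  then have "dist (p 0 0) ?x = r * dist (p 0 0) (p 0 1)"
    unfolding x by (simp add: dist_norm norm_minus_commute)
  then have t: "2^n * (dist (p 0 0) ?x / dist (p 0 0) (p 0 1)) = real i + s"
    using assms by (simp add: r_def)
  show ?thesis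
  proof (cases "s < 1")
    case True
    then have "nat \<lfloor>real i + s\<rfloor> = i"
      using assms by (simp add: floor_eq_iff nat_eq_iff)
    moreover have "min i (2^n - 1) = i"
      using assms by linarith
    ultimately show ?thesis
      unfolding koch_F_def Let_def t by (simp add: algebra_simps)
  next
    case False
    then have s: "s = 1"
      using assms by simp
    have fl: "nat \<lfloor>real i + s\<rfloor> = Suc i"
      by (simp add: s nat_eq_iff)
    show ?thesis
    proof (cases "Suc i < 2^n")
      case True
      then have "min (Suc i) (2^n - 1) = Suc i"
        by linarith
      then show ?thesis
        unfolding koch_F_def Let_def t fl by (simp add: s)
    next
      case False
      then have "min (Suc i) (2^n - 1) = i"
        using assms by linarith
      then show ?thesis
        unfolding koch_F_def Let_def t fl by (simp add: s)
    qed
  qed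
qed

definition koch_limit :: "koch_vertices \<Rightarrow> real^2 \<Rightarrow> real^2" where
  "koch_limit p x = lim (\<lambda>n. koch_F p n x)"

definition koch_index :: "koch_vertices \<Rightarrow> nat \<Rightarrow> real^2 \<Rightarrow> nat" where
  "koch_index p n x = Max {i. i < 2^n \<and> x \<in> koch_T p n i}"

text \<open>
  The infinite product is taken in \<^typ>\<open>ennreal\<close>, where the partial products of factors
  $\geq 1$ always converge, possibly to \<open>\<infinity>\<close>.
\<close>

definition koch_Pi :: "koch_vertices \<Rightarrow> real^2 \<Rightarrow> ennreal" where
  "koch_Pi p x = (\<Prod>n. ennreal (inverse (cos (koch_angle p n (koch_index p n x)))))"

definition Lambda_inf :: "koch_vertices \<Rightarrow> (real^2) set \<Rightarrow> (real^2) set" where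
  "Lambda_inf p A = {x \<in> A. koch_Pi p x = \<infinity>}"

definition Lambda_inf_inv :: "koch_vertices \<Rightarrow> (real^2) set \<Rightarrow> (real^2) set" where
  "Lambda_inf_inv p A = {x \<in> koch_A p 0 0. koch_limit p x \<in> Lambda_inf p A}"

end

theory Submission
  imports Defs
begin

text \<open>
  Two sibling caps see each other from their common apex under an obtuse angle. Hence the distance of
  two points of the curve \<open>F\<close> that are separated at generation \<open>n\<close> is at least their distance to the
  apex between them, and so, up to a constant, at least the distance of their parameters times the
  stretching factor \<open>2^n |A_{n,i}|\<close> of the last cap that they share. These factors do not decrease
  with \<open>n\<close>, so the inverse of \<open>F\<close> is Lipschitz and preserves \<open>H^1\<close>-null sets. Where the product
  of the inverse cosines is infinite the factors are unbounded, so for a Lipschitz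
  curve \<open>\<gamma>\<close> the composition of \<open>\<gamma>\<close> with the inverse of \<open>F\<close> has derivative zero there, and its
  image is null by Sard's theorem in dimension one. Division points form a countable set and are
  discarded. If the Koch type set were rectifiable, the preimage of \<open>\<Lambda>\<^sub>\<infinity>\<close> would be null.
\<close>

section \<open>Null sets of the one-dimensional Hausdorff measure\<close>

text \<open>For null sets the scale restriction is automatic: diameters that sum to at most
  \<open>\<delta>\<close> are each at most \<open>\<delta>\<close>.\<close>

lemma hausdorff1_null_iff:
  fixes S :: "'a::metric_space set"
  shows "hausdorff1 S = 0 \<longleftrightarrow>
    (\<forall>e>0. \<exists>C :: nat \<Rightarrow> 'a set. S \<subseteq> (\<Union>k. C k) \<and> (\<forall>k. bounded (C k)) \<and>
       (\<Sum>k. ennreal (diameter (C k))) \<le> ennreal e)"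
proof
  assume S: "hausdorff1 S = 0"
  have "hausdorff1_pre 1 S = 0"
    using S SUP_upper[of 1 "{0<..}" "\<lambda>\<delta>. hausdorff1_pre \<delta> S"] by (simp add: hausdorff1_def)
  then have small: "hausdorff1_pre 1 S < ennreal e" if "e > 0" for e
    using that by simp
  show "\<forall>e>0. \<exists>C :: nat \<Rightarrow> 'a set. S \<subseteq> (\<Union>k. C k) \<and> (\<forall>k. bounded (C k)) \<and>
       (\<Sum>k. ennreal (diameter (C k))) \<le> ennreal e"
  proof (intro allI impI)
    fix e :: real assume "e > 0"
    then obtain C :: "nat \<Rightarrow> 'a set" where "S \<subseteq> (\<Union>k. C k)" "\<forall>k. bounded (C k) \<and> diameter (C k) \<le> 1"
        "(\<Sum>k. ennreal (diameter (C k))) < ennreal e"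
      using small[of e] unfolding hausdorff1_pre_def Inf_less_iff by blast
    then show "\<exists>C :: nat \<Rightarrow> 'a set. S \<subseteq> (\<Union>k. C k) \<and> (\<forall>k. bounded (C k)) \<and>
       (\<Sum>k. ennreal (diameter (C k))) \<le> ennreal e"
      by (intro exI[of _ C]) simp
  qed
next
  assume R: "\<forall>e>0. \<exists>C :: nat \<Rightarrow> 'a set. S \<subseteq> (\<Union>k. C k) \<and> (\<forall>k. bounded (C k)) \<and>
       (\<Sum>k. ennreal (diameter (C k))) \<le> ennreal e"
  have "hausdorff1_pre \<delta> S \<le> 0" if \<delta>: "\<delta> > 0" for \<delta>
  proof (rule ennreal_le_epsilon)
    fix e :: real
    assume "e > 0"
    then obtain C :: "nat \<Rightarrow> 'a set" where C: "S \<subseteq> (\<Union>k. C k)" "\<And>k. bounded (C k)"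
        and sum: "(\<Sum>k. ennreal (diameter (C k))) \<le> ennreal (min e \<delta>)"
      using R \<delta> by (metis min_less_iff_conj)
    have "ennreal (diameter (C k)) \<le> ennreal \<delta>" for k
    proof -
      have "ennreal (diameter (C k)) = sum (\<lambda>k. ennreal (diameter (C k))) {k}"
        by simp
      also have "\<dots> \<le> (\<Sum>k. ennreal (diameter (C k)))"
        by (rule sum_le_suminf) auto
      also have "\<dots> \<le> ennreal \<delta>"
        using sum by (rule order_trans) (simp add: ennreal_leI)
      finally show ?thesis .
    qed
    then have "diameter (C k) \<le> \<delta>" for k
      using \<delta> by (simp add: ennreal_le_iff)
    then have "hausdorff1_pre \<delta> S \<le> (\<Sum>k. ennreal (diameter (C k)))"
      unfolding hausdorff1_pre_def using C by (intro Inf_lower) blast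
    also have "\<dots> \<le> ennreal e"
      using sum by (rule order_trans) (simp add: ennreal_leI)
    finally show "hausdorff1_pre \<delta> S \<le> 0 + ennreal e"
      by simp
  qed
  then show "hausdorff1 S = 0"
    unfolding hausdorff1_def by (simp add: SUP_eq_const)
qed

lemma hausdorff1_null_UN:
  fixes S :: "nat \<Rightarrow> 'a::metric_space set"
  assumes "\<And>n. hausdorff1 (S n) = 0"
  shows "hausdorff1 (\<Union>n. S n) = 0"
  unfolding hausdorff1_null_iff
proof (intro allI impI)
  fix e :: real
  assume e: "e > 0"
  have "\<exists>C :: nat \<Rightarrow> 'a set. S n \<subseteq> (\<Union>k. C k) \<and> (\<forall>k. bounded (C k)) \<and>
       (\<Sum>k. ennreal (diameter (C k))) \<le> ennreal (e * (1/2) ^ Suc n)" for n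
    using assms[of n] e unfolding hausdorff1_null_iff by simp
  then obtain C :: "nat \<Rightarrow> nat \<Rightarrow> 'a set" where
    C: "\<And>n. S n \<subseteq> (\<Union>k. C n k)" "\<And>n k. bounded (C n k)"
      "\<And>n. (\<Sum>k. ennreal (diameter (C n k))) \<le> ennreal (e * (1/2) ^ Suc n)"
    by metis
  define D where "D j = (case prod_decode j of (n, k) \<Rightarrow> C n k)" for j
  have "(\<Sum>j. ennreal (diameter (D j))) = (\<Sum>n. \<Sum>k. ennreal (diameter (C n k)))"
    using suminf_ennreal_2dimen[of "\<lambda>n. \<Sum>k. ennreal (diameter (C n k))"
        "\<lambda>(n, k). ennreal (diameter (C n k))"]
    by (simp add: D_def split_beta)
  also have "\<dots> \<le> (\<Sum>n. ennreal (e * (1/2) ^ Suc n))"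
    by (intro suminf_le C) auto
  also have "\<dots> = ennreal e"
    using sums_mult[OF power_half_series, of e] e by (intro suminf_ennreal_eq) auto
  finally have "(\<Sum>j. ennreal (diameter (D j))) \<le> ennreal e" .
  moreover have "(\<Union>n. S n) \<subseteq> (\<Union>j. D j)"
  proof
    fix x assume "x \<in> (\<Union>n. S n)"
    then obtain n k where "x \<in> C n k"
      using C(1) by blast
    then have "x \<in> D (prod_encode (n, k))"
      by (simp add: D_def)
    then show "x \<in> (\<Union>j. D j)"
      by blast
  qed
  moreover have "bounded (D j)" for j
    by (simp add: D_def split_beta C)
  ultimately show "\<exists>C :: nat \<Rightarrow> 'a set. (\<Union>n. S n) \<subseteq> (\<Union>k. C k) \<and> (\<forall>k. bounded (C k)) \<and>
       (\<Sum>k. ennreal (diameter (C k))) \<le> ennreal e"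
    by blast
qed

lemma hausdorff1_null_subset:
  assumes "hausdorff1 T = 0" "S \<subseteq> T"
  shows "hausdorff1 S = 0"
  using assms unfolding hausdorff1_null_iff by (meson order_trans)

lemma hausdorff1_null_Un:
  assumes "hausdorff1 S = 0" "hausdorff1 T = 0"
  shows "hausdorff1 (S \<union> T) = 0"
proof -
  have "hausdorff1 (\<Union>n::nat. if n = 0 then S else T) = 0"
    using assms by (intro hausdorff1_null_UN) auto
  then show ?thesis
    by (rule hausdorff1_null_subset) (auto split: if_splits)
qed

lemma hausdorff1_null_countable:
  fixes S :: "'a::metric_space set"
  assumes "countable S"
  shows "hausdorff1 S = 0"
proof (cases "S = {}")
  case True
  have "\<exists>C :: nat \<Rightarrow> 'a set. {} \<subseteq> (\<Union>k. C k) \<and> (\<forall>k. bounded (C k)) \<and>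
       (\<Sum>k. ennreal (diameter (C k))) \<le> ennreal e" for e
    by (intro exI[of _ "\<lambda>_. {}"]) simp
  then show ?thesis
    unfolding hausdorff1_null_iff True by blast
next
  case False
  then have "S \<subseteq> (\<Union>k. {from_nat_into S k})"
    using range_from_nat_into[OF False assms] by auto
  then show ?thesis
    unfolding hausdorff1_null_iff by (intro allI impI exI[of _ "\<lambda>k. {from_nat_into S k}"]) simp
qed

lemma hausdorff1_null_lipschitz_image:
  fixes f :: "'a::metric_space \<Rightarrow> 'b::metric_space"
  assumes S: "hausdorff1 S = 0" and f: "L-lipschitz_on S f"
  shows "hausdorff1 (f ` S) = 0"
  unfolding hausdorff1_null_iff
proof (intro allI impI)
  fix e :: real
  assume e: "e > 0"
  have L: "L \<ge> 0"
    using f by (rule lipschitz_on_nonneg)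
  \<comment> \<open>\<open>L\<close> may be 0, hence the denominator \<open>L + 1\<close>.\<close>
  then have "e / (L + 1) > 0"
    using e by simp
  then obtain C :: "nat \<Rightarrow> 'a set" where C: "S \<subseteq> (\<Union>k. C k)" "\<And>k. bounded (C k)"
      and sum: "(\<Sum>k. ennreal (diameter (C k))) \<le> ennreal (e / (L + 1))"
    using S unfolding hausdorff1_null_iff by metis
  have dist: "dist x y \<le> L * diameter (C k)" if xy: "x \<in> f ` (S \<inter> C k)" "y \<in> f ` (S \<inter> C k)" for x y k
  proof -
    obtain x' y' where "x = f x'" "y = f y'" "x' \<in> S" "y' \<in> S" "x' \<in> C k" "y' \<in> C k"
      using xy by blast
    then have "dist x y \<le> L * dist x' y'" "dist x' y' \<le> diameter (C k)"
      using lipschitz_onD[OF f] diameter_bounded_bound[OF C(2)] by auto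
    then show ?thesis
      using L by (meson mult_left_mono order_trans)
  qed
  have "diameter (f ` (S \<inter> C k)) \<le> L * diameter (C k)" for k
    using dist L diameter_ge_0[OF C(2)]
    unfolding diameter_def[of "f ` (S \<inter> C k)"] by (auto intro!: cSUP_least)
  then have "(\<Sum>k. ennreal (diameter (f ` (S \<inter> C k)))) \<le> (\<Sum>k. ennreal L * ennreal (diameter (C k)))"
    using L by (intro suminf_le) (auto simp: ennreal_mult'[symmetric] intro: ennreal_leI)
  also have "\<dots> = ennreal L * (\<Sum>k. ennreal (diameter (C k)))"
    by simp
  also have "\<dots> \<le> ennreal L * ennreal (e / (L + 1))"
    using sum by (rule mult_left_mono) simp
  also have "\<dots> \<le> ennreal e"
    using L e by (simp add: ennreal_mult'[symmetric] ennreal_leI field_simps)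
  finally have "(\<Sum>k. ennreal (diameter (f ` (S \<inter> C k)))) \<le> ennreal e" .
  moreover have "bounded (f ` (S \<inter> C k))" for k
    unfolding bounded_two_points using dist by blast
  moreover have "f ` S \<subseteq> (\<Union>k. f ` (S \<inter> C k))"
    using C(1) by blast
  ultimately show "\<exists>C :: nat \<Rightarrow> 'b set. f ` S \<subseteq> (\<Union>k. C k) \<and> (\<forall>k. bounded (C k)) \<and>
       (\<Sum>k. ennreal (diameter (C k))) \<le> ennreal e"
    by blast
qed

section \<open>Lebesgue null sets on the line and Sard's theorem in dimension one\<close>

lemma emeasure_box_real1:
  fixes u v :: "real^1"
  assumes "box u v \<noteq> {}"
  shows "emeasure lborel (box u v) = ennreal (diameter (cbox u v))"
proof -
  have uv: "u $ 1 < v $ 1"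
    using assms by (auto simp: interval_ne_empty_cart)
  then have "norm (v - u) = v $ 1 - u $ 1"
    by (simp add: norm_real)
  moreover have "(\<Prod>b\<in>Basis. (v - u) \<bullet> b) = v $ 1 - u $ 1"
    by (simp add: Basis_vec_def inner_axis)
  moreover have "\<forall>b\<in>Basis. u \<bullet> b \<le> v \<bullet> b"
    using uv by (simp add: Basis_vec_def inner_axis)
  ultimately show ?thesis
    by (subst emeasure_lborel_box) (auto simp: diameter_cbox dist_norm norm_minus_commute)
qed

text \<open>On the line the diameter of an interval is its Lebesgue measure. So nonoverlapping
  intervals that lie in an open set of small measure have a small sum of diameters.\<close>

lemma negligible_imp_hausdorff1_null:
  fixes S :: "(real^1) set"
  assumes "negligible S"
  shows "hausdorff1 S = 0"
proof -
  have "hausdorff1 (S \<inter> cbox (- vec (real n)) (vec (real n))) = 0" for n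
    unfolding hausdorff1_null_iff
  proof (intro allI impI)
    fix e :: real
    assume e: "e > 0"
    let ?T = "S \<inter> cbox (- vec (real n)) (vec (real n))"
    have neg: "negligible ?T"
      using assms by (rule negligible_subset) blast
    obtain U where U: "open U" "?T \<subseteq> U" and "emeasure lebesgue (U - ?T) < ennreal e"
      using sets_lebesgue_outer_open[OF negligible_imp_sets[OF neg] e] by metis
    moreover have "emeasure lebesgue (U - ?T) = emeasure lebesgue U"
      using neg U(1) by (intro emeasure_Diff_null_set) (auto simp: negligible_iff_null_sets)
    ultimately have mU: "emeasure lborel U < ennreal e"
      using U(1) by simp
    \<comment> \<open>Each box of the cover shares a point with \<open>?T\<close>, which lies in
      \<open>U\<close>; this gauge then keeps the box inside \<open>U\<close>.\<close>
    have g: "gauge (\<lambda>x. if x \<in> U then U else UNIV)"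
      using U(1) by (auto simp: gauge_def)
    have T: "?T \<subseteq> cbox (- vec (real n + 1)) (vec (real n + 1))"
      by (auto simp: mem_box_cart)
    have ne: "box (- vec (real n + 1)) (vec (real n + 1) :: real^1) \<noteq> {}"
      by (simp add: interval_ne_empty_cart)
    obtain \<D> where D: "countable \<D>"
        "\<And>K. K \<in> \<D> \<Longrightarrow> interior K \<noteq> {} \<and> (\<exists>c d. K = cbox c d)"
        "pairwise (\<lambda>A B. interior A \<inter> interior B = {}) \<D>"
        "\<And>K. K \<in> \<D> \<Longrightarrow> \<exists>x \<in> ?T \<inter> K. K \<subseteq> (if x \<in> U then U else UNIV)"
        "?T \<subseteq> \<Union>\<D>"
      by (rule covering_lemma[OF T ne g]) (rule that; assumption)
    \<comment> \<open>\<open>\<D>\<close> may be finite; the empty set fills the remaining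
      indices.\<close>
    define C where "C k = (if k \<in> to_nat_on \<D> ` \<D> then from_nat_into \<D> k else {})" for k
    have C: "C k = {} \<or> C k \<in> \<D>" for k
      using D(1) by (auto simp: C_def)
    have Cbox: "bounded (C k) \<and> C k \<subseteq> U \<and> ennreal (diameter (C k)) = emeasure lborel (interior (C k))" for k
    proof (cases "C k = {}")
      case False
      then have CD: "C k \<in> \<D>"
        using C by blast
      then obtain u v where uv: "C k = cbox u v" "box u v \<noteq> {}"
        using D(2) by fastforce
      moreover have "C k \<subseteq> U"
        using D(4)[OF CD] U(2) by (auto split: if_splits)
      ultimately show ?thesis
        by (simp add: emeasure_box_real1)
    qed simp
    have "disjoint_family (\<lambda>k. interior (C k))"
      unfolding disjoint_family_on_def
    proof (intro ballI impI)
      fix j k :: nat assume "j \<noteq> k"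
      then have "C j = {} \<or> C k = {} \<or> C j \<noteq> C k"
        using D(1) by (auto simp: C_def)
      then show "interior (C j) \<inter> interior (C k) = {}"
        using C[of j] C[of k] D(3) by (auto simp: pairwise_def)
    qed
    then have "(\<Sum>k. emeasure lborel (interior (C k))) = emeasure lborel (\<Union>k. interior (C k))"
      by (intro suminf_emeasure) auto
    also have "\<dots> \<le> emeasure lborel U"
      using Cbox interior_subset U(1) by (intro emeasure_mono) (blast, simp)
    finally have "(\<Sum>k. ennreal (diameter (C k))) \<le> ennreal e"
      using mU Cbox by simp
    moreover have "?T \<subseteq> (\<Union>k. C k)"
    proof
      fix x assume "x \<in> ?T"
      then obtain K where K: "K \<in> \<D>" "x \<in> K"
        using D(5) by blast
      then have "C (to_nat_on \<D> K) = K"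
        using D(1) by (simp add: C_def)
      then show "x \<in> (\<Union>k. C k)"
        using K(2) by blast
    qed
    ultimately show "\<exists>C :: nat \<Rightarrow> (real^1) set. ?T \<subseteq> (\<Union>k. C k) \<and> (\<forall>k. bounded (C k)) \<and>
       (\<Sum>k. ennreal (diameter (C k))) \<le> ennreal e"
      using Cbox by blast
  qed
  then have "hausdorff1 (\<Union>n. S \<inter> cbox (- vec (real n)) (vec (real n))) = 0"
    by (rule hausdorff1_null_UN)
  moreover have "S \<subseteq> (\<Union>n. S \<inter> cbox (- vec (real n)) (vec (real n)))"
  proof
    fix x assume "x \<in> S"
    moreover obtain n where "\<bar>x $ 1\<bar> \<le> real n"
      using real_arch_simple by blast
    ultimately show "x \<in> (\<Union>n. S \<inter> cbox (- vec (real n)) (vec (real n)))"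
      by (auto simp: mem_box_cart abs_le_iff intro!: exI[of _ n])
  qed
  ultimately show ?thesis
    by (rule hausdorff1_null_subset)
qed

text \<open>Sard's theorem applies on \<open>real^1\<close>, where a zero derivative has rank 0 < 1;
  the coordinate map then carries the null set back to the reals.\<close>

lemma hausdorff1_null_zero_derivative_image:
  fixes g :: "real \<Rightarrow> real"
  assumes "\<And>x. x \<in> S \<Longrightarrow> (g has_derivative (\<lambda>_. 0)) (at x within S)"
  shows "hausdorff1 (g ` S) = 0"
proof -
  define G :: "real^1 \<Rightarrow> real^1" where "G x = vec (g (x $ 1))" for x
  have "negligible (G ` (vec ` S))"
  proof (rule baby_Sard[where f' = "\<lambda>_ _. 0"])
    fix x :: "real^1" assume "x \<in> vec ` S"
    then obtain y where y: "x = vec y" "y \<in> S" by blast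
    show "(G has_derivative (\<lambda>_. 0)) (at x within vec ` S)"
    proof -
      have "(g has_derivative (\<lambda>_. 0)) (at (x $ 1) within (\<lambda>x. x $ 1) ` (vec ` S :: (real^1) set))"
        using assms[OF y(2)] by (simp add: y image_image)
      then have "((\<lambda>x. g (x $ 1)) has_derivative (\<lambda>_. 0)) (at x within vec ` S)"
        by (rule has_derivative_in_compose[OF bounded_linear_imp_has_derivative[OF bounded_linear_vec_nth]])
      then show ?thesis
        unfolding G_def by (subst has_derivative_componentwise_within) (simp add: Basis_vec_def inner_axis)
    qed
  next
    have "matrix (\<lambda>_. 0 :: real^1) = (0 :: real^1^1)"
      by (simp add: matrix_def vec_eq_iff)
    then show "rank (matrix (\<lambda>_. 0 :: real^1) :: real^1^1) < CARD(1)"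
      by (simp only: rank_0) simp
  qed simp
  then have "hausdorff1 (G ` (vec ` S)) = 0"
    by (rule negligible_imp_hausdorff1_null)
  then have "hausdorff1 ((\<lambda>x. x $ 1) ` (G ` (vec ` S))) = 0"
    by (rule hausdorff1_null_lipschitz_image) (auto intro!: lipschitz_onI[of _ _ 1] simp: dist_norm norm_real)
  then show ?thesis
    by (simp add: image_image G_def)
qed

text \<open>Turns the height condition of \<open>koch_construction\<close>, which is stated with
  \<open>hausdorff1\<close>, into a bound by the distance of the end points. The covers consist of
  \<open>N\<close> equal pieces.\<close>

lemma hausdorff1_closed_segment_le:
  fixes a b :: "'a::real_normed_vector"
  shows "hausdorff1 (closed_segment a b) \<le> ennreal (dist a b)"
  unfolding hausdorff1_def
proof (rule SUP_least)
  fix \<delta> :: real assume "\<delta> \<in> {0<..}"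
  then have \<delta>: "\<delta> > 0" by simp
  obtain N :: nat where N: "dist a b / \<delta> < real N"
    using reals_Archimedean2 by blast
  have "0 \<le> dist a b / \<delta>"
    using \<delta> by simp
  then have N0: "N > 0"
    using N by (metis of_nat_0_less_iff order_le_less_trans)
  define P where "P r = a + r *\<^sub>R (b - a)" for r
  define C where "C k = (if k < N then P ` {real k / N .. real (Suc k) / N} else {})" for k
  have dP: "dist (P r) (P s) = \<bar>r - s\<bar> * dist a b" for r s
    by (simp add: P_def dist_norm scaleR_left_diff_distrib[symmetric] norm_minus_commute)
  have dC: "dist x y \<le> dist a b / N" if xy: "x \<in> C k" "y \<in> C k" for x y k
  proof -
    obtain r s where "x = P r" "y = P s" "r \<in> {real k / N .. real (Suc k) / N}" "s \<in> {real k / N .. real (Suc k) / N}"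
      using xy by (auto simp: C_def split: if_splits)
    moreover from this have "\<bar>r - s\<bar> \<le> 1 / N"
      by (auto simp: abs_le_iff add_divide_distrib)
    ultimately show ?thesis
      using mult_right_mono[of "\<bar>r - s\<bar>" "1 / N" "dist a b"] by (simp add: dP)
  qed
  have diam: "diameter (C k) \<le> dist a b / N" for k
    using dC by (intro diameter_le) (auto simp: dist_norm[symmetric])
  have "dist a b / N \<le> \<delta>"
    using N N0 \<delta> by (simp add: field_simps)
  then have "\<forall>k. bounded (C k) \<and> diameter (C k) \<le> \<delta>"
    using dC diam by (meson bounded_two_points order_trans)
  moreover have "closed_segment a b \<subseteq> (\<Union>k. C k)"
  proof
    fix x assume "x \<in> closed_segment a b"
    then obtain r where r: "0 \<le> r" "r \<le> 1" "x = P r"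
      by (auto simp: closed_segment_def P_def algebra_simps)
    show "x \<in> (\<Union>k. C k)"
    \<comment> \<open>For \<open>r = 1\<close> the floor of \<open>r * N\<close> would be
      \<open>N\<close>, one past the last piece.\<close>
    proof (cases "r = 1")
      case True
      then have "x \<in> C (N - 1)"
        using N0 r by (auto simp: C_def of_nat_diff field_simps)
      then show ?thesis by blast
    next
      case False
      define k where "k = nat \<lfloor>r * N\<rfloor>"
      have "r * N < N"
        using False r N0 by simp
      moreover have k: "real k \<le> r * N" "r * N < real k + 1"
        using r by (auto simp: k_def)
      ultimately have "k < N"
        by linarith
      then have "x \<in> C k"
        using k N0 r by (auto simp: C_def field_simps)
      then show ?thesis by blast
    qed
  qed
  ultimately have "hausdorff1_pre \<delta> (closed_segment a b) \<le> (\<Sum>k. ennreal (diameter (C k)))"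
    unfolding hausdorff1_pre_def by (intro Inf_lower) blast
  also have "\<dots> = (\<Sum>k<N. ennreal (diameter (C k)))"
    by (rule suminf_finite) (auto simp: C_def)
  also have "\<dots> \<le> (\<Sum>k<N. ennreal (dist a b / N))"
    using diam by (intro sum_mono ennreal_leI) auto
  also have "\<dots> = ennreal (dist a b)"
    using N0 by (simp add: ennreal_of_nat_eq_real_of_nat ennreal_mult'[symmetric])
  finally show "hausdorff1_pre \<delta> (closed_segment a b) \<le> ennreal (dist a b)" .
qed

section \<open>Flat triangular caps\<close>

text \<open>The apex \<open>c\<close> of an isosceles triangle projects onto the midpoint of its
  base.\<close>

lemma equidistant_inner:
  fixes a b c :: "'a::real_inner"
  assumes "dist a c = dist b c"
  shows "(b - a) \<bullet> (c - a) = (dist a b)\<^sup>2 / 2"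
proof -
  have "norm (c - a) = norm ((c - a) - (b - a))"
    using assms by (simp add: dist_norm norm_minus_commute)
  then have "(norm (c - a))\<^sup>2 = (norm ((c - a) - (b - a)))\<^sup>2"
    by simp
  then show ?thesis
    unfolding power2_norm_eq_inner dist_norm
    by (simp add: inner_diff_left inner_diff_right inner_commute)
qed

lemma is_cap_distinct:
  assumes "is_cap a b c"
  shows "a \<noteq> b" "a \<noteq> c" "b \<noteq> c"
  using assms by (auto simp: is_cap_def insert_commute)

text \<open>In the right triangle cut off by the altitude, half the base is adjacent to the angle
  and the leg is the hypotenuse. The factors of \<open>koch_Pi\<close> thereby become ratios of edge
  lengths.\<close>

lemma cos_base_angle:
  assumes "is_cap a b c"
  shows "cos (base_angle a b c) = dist a b / (2 * dist a c)"
proof -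
  have "((b - a) \<bullet> (c - a)) / (norm (b - a) * norm (c - a)) = ((dist a b)\<^sup>2 / 2) / (dist a b * dist a c)"
  proof -
    have "(b - a) \<bullet> (c - a) = (dist a b)\<^sup>2 / 2"
      using assms by (intro equidistant_inner) (simp add: is_cap_def)
    then show ?thesis
      by (simp only: dist_norm norm_minus_commute)
  qed
  also have "\<dots> = dist a b / (2 * dist a c)"
    using is_cap_distinct[OF assms] by (simp add: power2_eq_square)
  finally have "base_angle a b c = arccos (dist a b / (2 * dist a c))"
    by (simp add: base_angle_def angle_at_def)
  moreover have "dist a b \<le> 2 * dist a c"
    using assms dist_triangle2[of a b c] by (simp add: is_cap_def)
  ultimately show ?thesis
    using is_cap_distinct[OF assms] by (simp add: cos_arccos order_trans[of "-1" 0])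
qed

lemma base_angle_bounds:
  assumes "is_cap a b c"
  shows "0 \<le> base_angle a b c" "base_angle a b c \<le> pi"
proof -
  have "\<bar>((b - a) \<bullet> (c - a)) / (norm (b - a) * norm (c - a))\<bar> \<le> 1"
    using is_cap_distinct[OF assms] Cauchy_Schwarz_ineq2[of "b - a" "c - a"]
    by (simp add: abs_mult field_simps)
  then have "-1 \<le> ((b - a) \<bullet> (c - a)) / (norm (b - a) * norm (c - a))"
      "((b - a) \<bullet> (c - a)) / (norm (b - a) * norm (c - a)) \<le> 1"
    by (simp_all only: abs_le_iff minus_le_iff)
  then show "0 \<le> base_angle a b c" "base_angle a b c \<le> pi"
    unfolding base_angle_def angle_at_def by (rule arccos_lbound, rule arccos_ubound)
qed

text \<open>The bound \<open>51/100\<close> exceeds \<open>sqrt (1/4 + 1/100^2)\<close>, the value for a cap whose height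
  is \<open>1/100\<close> of its base; in terms of the base angle it is a lower bound on the cosine.\<close>

definition flat_cap :: "'a::metric_space \<Rightarrow> 'a \<Rightarrow> 'a \<Rightarrow> bool" where
  "flat_cap a b c \<longleftrightarrow> dist a c = dist b c \<and> dist a c \<le> 51/100 * dist a b"

lemma flat_cap_if_low:
  assumes "is_cap a b c" "cap_height a b c \<le> 1/100 * dist a b"
  shows "flat_cap a b c"
proof -
  have eq: "dist a c = dist b c"
    using assms by (simp add: is_cap_def)
  obtain z where z: "z \<in> affine hull {a, b}" "infdist c (affine hull {a, b}) = dist c z"
    using infdist_attains_inf[of "affine hull {a, b}" c] by (auto simp: closed_affine_hull)
  then obtain u r where "z = u *\<^sub>R a + r *\<^sub>R b" "u + r = 1"
    by (auto simp: affine_hull_2)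
  then have zr: "z = a + r *\<^sub>R (b - a)"
    by (simp add: algebra_simps flip: scaleR_add_left)
  define q E where "q = c - a" and "E = b - a"
  have qE: "E \<bullet> q = (norm E)\<^sup>2 / 2"
    using equidistant_inner[OF eq] by (simp add: q_def E_def dist_norm norm_minus_commute)
  have "dist c z = norm (q - r *\<^sub>R E)"
    by (simp add: zr q_def E_def dist_norm algebra_simps)
  then have "norm (q - r *\<^sub>R E) \<le> 1/100 * norm E"
    using assms(2) z(2) by (simp add: cap_height_def E_def dist_norm norm_minus_commute)
  then have "(norm (q - r *\<^sub>R E))\<^sup>2 \<le> (1/100 * norm E)\<^sup>2"
    by (intro power_mono) auto
  moreover have "(norm (q - r *\<^sub>R E))\<^sup>2 = (norm q)\<^sup>2 - 2 * r * (E \<bullet> q) + r\<^sup>2 * (norm E)\<^sup>2"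
    unfolding power2_norm_eq_inner by (simp add: inner_diff_left inner_diff_right inner_commute power2_eq_square)
  ultimately have "(norm q)\<^sup>2 \<le> (1/10000 + r - r\<^sup>2) * (norm E)\<^sup>2"
    unfolding qE by (simp add: power_mult_distrib algebra_simps power2_eq_square)
  \<comment> \<open>\<open>r - r\<^sup>2\<close> is at most 1/4 wherever the nearest point lies, and
    1/4 + 1/10000 is below \<open>(51/100)\<^sup>2 = 0.2601\<close>.\<close>
  also have "\<dots> \<le> (51/100)\<^sup>2 * (norm E)\<^sup>2"
    using zero_le_power2[of "r - 1/2"]
    by (intro mult_right_mono) (auto simp: power2_eq_square algebra_simps)
  finally have "norm q \<le> 51/100 * norm E"
    by (simp add: power_mult_distrib[symmetric] power2_le_iff_abs_le)
  then show ?thesis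
    using eq by (simp add: flat_cap_def q_def E_def dist_norm norm_minus_commute)
qed

text \<open>By \<open>cos_base_angle\<close>, flatness of a cap means that the cosine of its base
  angle is at least 100/102, and cosine decreases on [0, pi].\<close>

lemma flat_cap_if_smaller_angle:
  assumes "is_cap a b c" "is_cap a' b' c'" "flat_cap a' b' c'" "base_angle a b c \<le> base_angle a' b' c'"
  shows "flat_cap a b c"
proof -
  have "cos (base_angle a' b' c') \<le> cos (base_angle a b c)"
    using assms base_angle_bounds by (intro cos_monotone_0_pi_le) auto
  then have "dist a' b' / (2 * dist a' c') \<le> dist a b / (2 * dist a c)"
    by (simp add: cos_base_angle assms)
  moreover have "100/102 \<le> dist a' b' / (2 * dist a' c')"
    using assms(3) is_cap_distinct[OF assms(2)] by (simp add: flat_cap_def field_simps)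
  ultimately have "100/102 \<le> dist a b / (2 * dist a c)"
    by linarith
  then show ?thesis
    using assms(1) is_cap_distinct[OF assms(1)] by (simp add: flat_cap_def is_cap_def field_simps)
qed

text \<open>The diameter of a triangle is attained at two vertices, and the legs of a flat cap are
  no longer than its base.\<close>

lemma flat_cap_dist_le:
  assumes "flat_cap a b c" "x \<in> cap a b c" "y \<in> cap a b c"
  shows "dist x y \<le> dist a b"
proof -
  obtain u v where "u \<in> {a, b, c}" "v \<in> {a, b, c}" "norm (x - y) \<le> norm (u - v)"
    using simplex_extremal_le_exists[of "{a, b, c}" x y] assms(2,3)
    unfolding cap_def by (meson finite.emptyI finite.insertI)
  moreover have "dist b c \<le> dist a b"
    using assms(1) zero_le_dist[of a b] unfolding flat_cap_def by linarith
  then have "dist u v \<le> dist a b" if "u \<in> {a, b, c}" "v \<in> {a, b, c}" for u v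
    using that assms(1) by (auto simp: flat_cap_def dist_commute)
  ultimately show ?thesis
    by (fastforce simp: dist_norm)
qed

text \<open>With the apex of a cap as origin, \<open>u\<close> and \<open>w\<close> are the end points of its base, and \<open>s\<close> and
  \<open>t\<close> are the apexes of the caps on its two edges. All angles between the two sides are close to
  the apex angle, hence obtuse.\<close>

lemma flat_caps_obtuse_vectors:
  fixes u w s t :: "'a::real_inner"
  assumes uw: "norm u = norm w" "norm u \<le> 51/100 * norm (u - w)"
    and s: "norm (s - u) = norm s" "norm s \<le> 51/100 * norm u"
    and t: "norm (t - w) = norm t" "norm t \<le> 51/100 * norm w"
  shows "u \<bullet> w \<le> 0" "s \<bullet> w \<le> 0" "u \<bullet> t \<le> 0" "s \<bullet> t \<le> 0"
proof -
  define l where "l = norm u"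
  have l: "l \<ge> 0" "norm u = l" "norm w = l"
    using uw by (auto simp: l_def)
  have "l\<^sup>2 \<le> (51/100 * norm (u - w))\<^sup>2"
    using uw l by (intro power_mono) auto
  also have "\<dots> = (51/100)\<^sup>2 * (2 * l\<^sup>2 - 2 * (u \<bullet> w))"
  proof -
    have "(norm (u - w))\<^sup>2 = 2 * l\<^sup>2 - 2 * (u \<bullet> w)"
      using dot_norm_neg[of u w] l by simp
    then show ?thesis
      by (simp only: power_mult_distrib)
  qed
  finally have "l\<^sup>2 \<le> (51/100)\<^sup>2 * (2 * l\<^sup>2 - 2 * (u \<bullet> w))" .
  \<comment> \<open>The exact constant is (1 - 0.5202) / 0.5202, about 0.92.\<close>
  then have *: "u \<bullet> w \<le> - 9/10 * l\<^sup>2"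
    using zero_le_power2[of l] unfolding power2_eq_square[of "51/100"] by argo
  then show "u \<bullet> w \<le> 0"
    using zero_le_power2[of l] by linarith
  \<comment> \<open>An apex is close to the midpoint of its base: the squared height is at most
    \<open>(0.2601 - 0.25) * l\<^sup>2\<close>, and 0.0101 is below
    \<open>(11/100)\<^sup>2\<close>.\<close>
  have off: "norm (z - (1/2) *\<^sub>R v) \<le> 11/100 * l"
    if "norm (z - v) = norm z" "norm z \<le> 51/100 * norm v" "norm v = l" for z v :: 'a
  proof -
    have "(norm (z - v))\<^sup>2 = (norm z)\<^sup>2"
      using that by simp
    then have zv: "z \<bullet> v = l\<^sup>2 / 2"
      unfolding that(3)[symmetric] power2_norm_eq_inner
      by (simp add: inner_diff_left inner_diff_right inner_commute)
    have "(norm (z - (1/2) *\<^sub>R v))\<^sup>2 = (norm z)\<^sup>2 - z \<bullet> v + l\<^sup>2 / 4"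
      unfolding that(3)[symmetric] power2_norm_eq_inner
      by (simp add: inner_diff_left inner_diff_right inner_commute)
    also have "\<dots> \<le> (51/100 * l)\<^sup>2 - l\<^sup>2 / 4"
      using power_mono[OF that(2), of 2] that(3) by (simp add: zv)
    also have "\<dots> \<le> (11/100 * l)\<^sup>2"
      by (simp add: power2_eq_square)
    finally show ?thesis
      using l by (simp add: power2_le_iff_abs_le)
  qed
  define m n where "m = s - (1/2) *\<^sub>R u" and "n = t - (1/2) *\<^sub>R w"
  have mn: "norm m \<le> 11/100 * l" "norm n \<le> 11/100 * l"
    using off[OF s] off[OF t] l by (simp_all add: m_def n_def)
  have st: "s = (1/2) *\<^sub>R u + m" "t = (1/2) *\<^sub>R w + n"
    by (simp_all add: m_def n_def)
  have CS: "x \<bullet> y \<le> r * r' * l\<^sup>2" if "norm x \<le> r * l" "norm y \<le> r' * l" "0 \<le> r" for x y :: 'a and r r'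
  proof -
    have "x \<bullet> y \<le> norm x * norm y"
      by (rule norm_cauchy_schwarz)
    also have "\<dots> \<le> (r * l) * (r' * l)"
      using that l by (intro mult_mono) auto
    finally show ?thesis
      by (simp add: power2_eq_square mult_ac)
  qed
  have 1: "m \<bullet> w \<le> 11/100 * 1 * l\<^sup>2" "n \<bullet> u \<le> 11/100 * 1 * l\<^sup>2" "m \<bullet> n \<le> 11/100 * (11/100) * l\<^sup>2"
    using mn l by (intro CS; simp)+
  \<comment> \<open>In multiples of \<open>l\<^sup>2\<close>, the first two products are at most
    -0.45 + 0.11 and the last one is at most -0.225 + 0.11 + 0.0121.\<close>
  have "s \<bullet> w = u \<bullet> w / 2 + m \<bullet> w" "u \<bullet> t = u \<bullet> w / 2 + n \<bullet> u"
    "s \<bullet> t = u \<bullet> w / 4 + m \<bullet> w / 2 + n \<bullet> u / 2 + m \<bullet> n"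
    by (simp_all add: st inner_add_left inner_add_right inner_commute)
  then show "s \<bullet> w \<le> 0" "u \<bullet> t \<le> 0" "s \<bullet> t \<le> 0"
    using * 1 zero_le_power2[of l] by linarith+
qed

text \<open>Seen from \<open>v\<close>, each cap lies in the cone spanned by its other two vertices;
  by bilinearity the signs for the four pairs of these vertices decide.\<close>

lemma flat_caps_obtuse:
  assumes v: "flat_cap a b v" and c: "flat_cap a v c" and d: "flat_cap v b d"
    and x: "x \<in> cap a v c" and y: "y \<in> cap v b d"
  shows "(x - v) \<bullet> (y - v) \<le> 0"
proof -
  obtain \<alpha> \<beta> \<gamma> where x': "0 \<le> \<alpha>" "0 \<le> \<gamma>" "\<alpha> + \<beta> + \<gamma> = 1" "x = \<alpha> *\<^sub>R a + \<beta> *\<^sub>R v + \<gamma> *\<^sub>R c"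
    using x by (auto simp: cap_def convex_hull_3)
  obtain \<alpha>' \<beta>' \<gamma>' where y': "0 \<le> \<beta>'" "0 \<le> \<gamma>'" "\<alpha>' + \<beta>' + \<gamma>' = 1" "y = \<alpha>' *\<^sub>R v + \<beta>' *\<^sub>R b + \<gamma>' *\<^sub>R d"
    using y by (auto simp: cap_def convex_hull_3)
  have e: "\<beta> = 1 - \<alpha> - \<gamma>" "\<alpha>' = 1 - \<beta>' - \<gamma>'"
    using x'(3) y'(3) by auto
  have xy: "x - v = \<alpha> *\<^sub>R (a - v) + \<gamma> *\<^sub>R (c - v)" "y - v = \<beta>' *\<^sub>R (b - v) + \<gamma>' *\<^sub>R (d - v)"
    unfolding x'(4) y'(4) e by (simp_all add: algebra_simps)
  have "(a - v) \<bullet> (b - v) \<le> 0" "(c - v) \<bullet> (b - v) \<le> 0" "(a - v) \<bullet> (d - v) \<le> 0" "(c - v) \<bullet> (d - v) \<le> 0"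
    using v c d by (intro flat_caps_obtuse_vectors[of "a - v" "b - v" "c - v" "d - v"];
        simp add: flat_cap_def dist_norm norm_minus_commute)+
  then show ?thesis
    using x'(1,2) y'(1,2) unfolding xy inner_add_left inner_add_right inner_scaleR_left inner_scaleR_right
    by (intro add_nonpos_nonpos mult_nonneg_nonpos)
qed

text \<open>By the law of cosines, the side opposite a right or obtuse angle is the longest.\<close>

lemma dist_ge_if_obtuse:
  fixes x y v :: "'a::real_inner"
  assumes "(x - v) \<bullet> (y - v) \<le> 0"
  shows "dist x v \<le> dist x y" "dist y v \<le> dist x y"
proof -
  have "(dist x y)\<^sup>2 = (dist x v)\<^sup>2 + (dist y v)\<^sup>2 - 2 * ((x - v) \<bullet> (y - v))"
    using dot_norm_neg[of "x - v" "y - v"] by (simp add: dist_norm)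
  then have "(dist x v)\<^sup>2 \<le> (dist x y)\<^sup>2" "(dist y v)\<^sup>2 \<le> (dist x y)\<^sup>2"
    using assms zero_le_power2[of "dist x v"] zero_le_power2[of "dist y v"] by linarith+
  then show "dist x v \<le> dist x y" "dist y v \<le> dist x y"
    by (auto intro: power2_le_imp_le)
qed

section \<open>Infinite products and dyadic parameters\<close>

text \<open>Bounded partial products would increase to a real limit, which would be the value of the
  product.\<close>

lemma prodinf_ennreal_infinity_unbounded:
  fixes c :: "nat \<Rightarrow> real"
  assumes c: "\<And>i. c i \<ge> 1" and inf: "(\<Prod>i. ennreal (c i)) = \<infinity>"
  shows "\<exists>n. K < (\<Prod>i\<le>n. c i)"
proof (rule ccontr)
  assume "\<nexists>n. K < (\<Prod>i\<le>n. c i)"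
  then have K: "(\<Prod>i\<le>n. c i) \<le> K" for n
    by (auto simp: not_less)
  let ?P = "\<lambda>n. \<Prod>i\<le>n. c i"
  have "incseq ?P"
  proof (rule incseq_SucI)
    fix n
    have "0 \<le> ?P n"
      using c by (intro prod_nonneg) (auto intro: order_trans[of 0 1])
    then show "?P n \<le> ?P (Suc n)"
      using mult_left_mono[OF c[of "Suc n"], of "?P n"] by simp
  qed
  then obtain q where q: "?P \<longlonglongrightarrow> q" "\<And>n. ?P n \<le> q"
    using incseq_convergent[of ?P K] K by blast
  have "1 \<le> q"
    using q(2)[of 0] c[of 0] by simp
  have "(\<Prod>i\<le>n. ennreal (c i)) = ennreal (?P n)" for n
    using c by (intro prod_ennreal) (auto intro: order_trans[of 0 1])
  then have lim: "(\<lambda>n. \<Prod>i\<le>n. ennreal (c i)) \<longlonglongrightarrow> ennreal q"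
    using q(1) by (simp add: tendsto_ennrealI)
  have ne: "ennreal (c i) \<noteq> 0" for i
    using c[of i] by simp
  have "(\<lambda>i. ennreal (c i)) has_prod ennreal q"
    using lim \<open>1 \<le> q\<close> by (simp add: has_prod_def raw_has_prod_def)
  \<comment> \<open>\<open>prodinf\<close> is a definite description, so uniqueness is shown as
    well; nonzero factors exclude the clause of \<open>has_prod\<close> for products with a zero
    factor.\<close>
  moreover have "r = ennreal q" if "(\<lambda>i. ennreal (c i)) has_prod r" for r
    using that lim ne by (auto simp: has_prod_def raw_has_prod_def intro: LIMSEQ_unique)
  ultimately have "(\<Prod>i. ennreal (c i)) = ennreal q"
    unfolding prodinf_def by (rule the_equality)
  then show False
    using inf by simp
qed

section \<open>Dyadic indices of parameters in [0, 1]\<close>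

definition dyadic_index :: "nat \<Rightarrow> real \<Rightarrow> nat" where
  "dyadic_index n t = nat \<lfloor>2^n * t\<rfloor>"

text \<open>Away from the division points, which include 0 and 1, all inequalities for the index are
  strict: indices are locally constant, and a curve point lies in a single cap of each
  generation.\<close>

definition nondyadic :: "real set" where
  "nondyadic = {0..1} - (\<lambda>(n, i). real i / 2^n) ` (UNIV :: (nat \<times> nat) set)"

lemma nondyadic_bounds:
  assumes "t \<in> nondyadic"
  shows "0 < t" "t < 1"
proof -
  have "t \<noteq> real i / 2^n" for i n :: nat
    using assms by (auto simp: nondyadic_def)
  from this[of 0 0] this[of 1 0] show "0 < t" "t < 1"
    using assms by (auto simp: nondyadic_def)
qed

lemma nondyadic_neq:
  assumes "t \<in> nondyadic"
  shows "2^n * t \<noteq> real i"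
proof
  assume "2^n * t = real i"
  then have "t = real i / 2^n"
    by (simp add: field_simps)
  then show False
    using assms by (auto simp: nondyadic_def)
qed

lemma dyadic_index_bounds:
  assumes "t \<in> nondyadic"
  shows "real (dyadic_index n t) < 2^n * t" "2^n * t < real (dyadic_index n t) + 1"
    "dyadic_index n t < 2^n"
proof -
  have *: "real (dyadic_index n t) = of_int \<lfloor>2^n * t\<rfloor>"
    using nondyadic_bounds[OF assms] by (simp add: dyadic_index_def)
  show "real (dyadic_index n t) < 2^n * t"
    using nondyadic_neq[OF assms, of n "dyadic_index n t"] unfolding * by linarith
  also have "\<dots> < 2^n"
    using nondyadic_bounds[OF assms] by simp
  finally have "real (dyadic_index n t) < real (2^n)"
    by simp
  then show "dyadic_index n t < 2^n"
    by (simp only: of_nat_less_iff)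
  show "2^n * t < real (dyadic_index n t) + 1"
    unfolding * by linarith
qed

lemma dyadic_index_eqI:
  assumes "t \<in> nondyadic" "real i < 2^n * t" "2^n * t < real i + 1"
  shows "dyadic_index n t = i"
  using dyadic_index_bounds[OF assms(1), of n] assms by linarith

lemma dyadic_index_0: "t \<in> nondyadic \<Longrightarrow> dyadic_index 0 t = 0"
  using nondyadic_bounds[of t] by (intro dyadic_index_eqI) auto

lemma dyadic_index_Suc:
  assumes "t \<in> nondyadic"
  shows "dyadic_index (Suc n) t div 2 = dyadic_index n t"
  using dyadic_index_bounds[OF assms, of n] dyadic_index_bounds[OF assms, of "Suc n"]
  by simp

lemma dyadic_index_Suc_cases:
  assumes "t \<in> nondyadic"
  obtains "dyadic_index (Suc n) t = 2 * dyadic_index n t" | "dyadic_index (Suc n) t = 2 * dyadic_index n t + 1"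
  using dyadic_index_Suc[OF assms, of n] by linarith

lemma dyadic_index_locally_constant:
  assumes "t \<in> nondyadic"
  shows "\<exists>r>0. \<forall>s\<in>nondyadic. \<bar>s - t\<bar> < r \<longrightarrow> dyadic_index n s = dyadic_index n t"
proof -
  let ?i = "real (dyadic_index n t)"
  \<comment> \<open>The distance from \<open>t\<close> to the nearer end of its part of generation
    \<open>n\<close>.\<close>
  define r where "r = min (2^n * t - ?i) (?i + 1 - 2^n * t) / 2^n"
  have "dyadic_index n s = dyadic_index n t" if "s \<in> nondyadic" "\<bar>s - t\<bar> < r" for s
  proof -
    have "\<bar>2^n * s - 2^n * t\<bar> = 2^n * \<bar>s - t\<bar>"
      by (simp add: abs_mult flip: right_diff_distrib)
    also have "\<dots> < min (2^n * t - ?i) (?i + 1 - 2^n * t)"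
      using that(2) by (simp add: r_def field_simps)
    finally show ?thesis
      by (intro dyadic_index_eqI that(1)) linarith+
  qed
  moreover have "r > 0"
    using dyadic_index_bounds[OF assms, of n] by (simp add: r_def)
  ultimately show ?thesis
    by blast
qed

text \<open>Parameters in a common part of generation \<open>n\<close> satisfy
  \<open>2^n * \<bar>s - t\<bar> < 1\<close>, which fails for large \<open>n\<close>. So the two
  part ways at some generation.\<close>

lemma dyadic_index_separates:
  assumes s: "s \<in> nondyadic" and t: "t \<in> nondyadic" and "s \<noteq> t" "dyadic_index m s = dyadic_index m t"
  shows "\<exists>n\<ge>m. dyadic_index n s = dyadic_index n t \<and> dyadic_index (Suc n) s \<noteq> dyadic_index (Suc n) t"
proof (rule ccontr)
  assume same: "\<not> ?thesis"
  have same': "dyadic_index n s = dyadic_index n t" if "m \<le> n" for n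
    using that by (induction n rule: dec_induct) (use assms same in auto)
  obtain n where n: "1 / \<bar>s - t\<bar> < 2^n"
    using real_arch_pow[of 2 "1 / \<bar>s - t\<bar>"] by auto
  also have "(2::real)^n \<le> 2^(max m n)"
    by (intro power_increasing) auto
  finally have "1 < 2^(max m n) * \<bar>s - t\<bar>"
    using \<open>s \<noteq> t\<close> by (simp add: field_simps)
  also have "\<dots> = \<bar>2^(max m n) * s - 2^(max m n) * t\<bar>"
    by (simp add: abs_mult flip: right_diff_distrib)
  finally show False
    using dyadic_index_bounds[OF s, of "max m n"] dyadic_index_bounds[OF t, of "max m n"]
      same'[of "max m n"] by linarith
qed

section \<open>The Koch curve\<close>

locale koch =
  fixes p :: koch_vertices
  assumes koch: "koch_construction p"
begin

section \<open>Edges and caps of successive generations\<close>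

definition edge :: "nat \<Rightarrow> nat \<Rightarrow> real" where
  "edge n i = dist (p n i) (p n (Suc i))"

definition apex :: "nat \<Rightarrow> nat \<Rightarrow> real^2" where
  "apex n i = p (Suc n) (2 * i + 1)"

lemma vertex_double: "i \<le> 2^n \<Longrightarrow> p (Suc n) (2 * i) = p n i"
  using koch by (simp add: koch_construction_def)

lemma child_vertices:
  assumes "i < 2^n"
  shows "p (Suc n) (2 * i) = p n i" "p (Suc n) (Suc (2 * i)) = apex n i"
    "p (Suc n) (Suc (Suc (2 * i))) = p n (Suc i)"
  using assms vertex_double[of i n] vertex_double[of "Suc i" n] by (auto simp: apex_def)

lemma koch_T_eq: "koch_T p n i = cap (p n i) (p n (Suc i)) (apex n i)"
  by (simp add: koch_T_def apex_def)

lemma koch_angle_eq: "koch_angle p n i = base_angle (p n i) (p n (Suc i)) (apex n i)"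
  by (simp add: koch_angle_def apex_def)

lemma is_cap_apex: "i < 2^n \<Longrightarrow> is_cap (p n i) (p n (Suc i)) (apex n i)"
  using koch by (simp add: koch_construction_def apex_def)

lemma half_index: "(k::nat) < 2^Suc n \<Longrightarrow> k div 2 < 2^n \<and> k \<in> {2 * (k div 2), 2 * (k div 2) + 1}"
  by auto

lemma koch_child:
  assumes "k < 2^Suc n"
  shows "koch_T p (Suc n) k \<subseteq> koch_T p n (k div 2)"
    "koch_angle p (Suc n) k \<le> koch_angle p n (k div 2)"
  using koch half_index[OF assms] unfolding koch_construction_def by blast+

text \<open>The height condition gives flatness at generation 0; after that, base angles do not
  increase from a cap to its children.\<close>

lemma flat: "i < 2^n \<Longrightarrow> flat_cap (p n i) (p n (Suc i)) (apex n i)"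
proof (induction n arbitrary: i)
  case 0
  obtain \<epsilon> where e: "0 < \<epsilon>" "\<epsilon> < 1/100"
      "ennreal (cap_height (p 0 0) (p 0 1) (p 1 1)) = ennreal \<epsilon> * hausdorff1 (koch_A p 0 0)"
    using koch by (auto simp: koch_construction_def)
  have "ennreal (cap_height (p 0 0) (p 0 1) (p 1 1)) \<le> ennreal \<epsilon> * ennreal (dist (p 0 0) (p 0 1))"
    unfolding e(3) koch_A_def using hausdorff1_closed_segment_le by (intro mult_left_mono) auto
  also have "\<dots> \<le> ennreal (1/100 * dist (p 0 0) (p 0 1))"
    using e by (simp only: ennreal_mult'[symmetric] less_imp_le) (intro ennreal_leI mult_right_mono; simp)
  finally have "cap_height (p 0 0) (p 0 1) (p 1 1) \<le> 1/100 * dist (p 0 0) (p 0 1)"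
    by (subst (asm) ennreal_le_iff) auto
  then show ?case
    using 0 is_cap_apex[OF 0] by (auto intro!: flat_cap_if_low simp: apex_def)
next
  case (Suc n)
  then have "flat_cap (p n (i div 2)) (p n (Suc (i div 2))) (apex n (i div 2))"
    using half_index by blast
  moreover have "base_angle (p (Suc n) i) (p (Suc n) (Suc i)) (apex (Suc n) i)
      \<le> base_angle (p n (i div 2)) (p n (Suc (i div 2))) (apex n (i div 2))"
    using koch_child(2)[OF Suc.prems] by (simp add: koch_angle_eq)
  ultimately show ?case
    using Suc.prems half_index is_cap_apex by (blast intro: flat_cap_if_smaller_angle)
qed

lemma edge_pos: "i < 2^n \<Longrightarrow> 0 < edge n i"
  using is_cap_distinct(1)[OF is_cap_apex] by (simp add: edge_def)

lemma edge_children: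
  assumes "i < 2^n"
  shows "edge (Suc n) (2 * i) = dist (p n i) (apex n i)"
    "edge (Suc n) (Suc (2 * i)) = dist (p n i) (apex n i)"
  using flat[OF assms] by (simp_all add: edge_def child_vertices[OF assms] flat_cap_def dist_commute)

text \<open>The bounds are flatness and the triangle inequality. Both children have the leg of their
  parent as edge length, so either of them may stand in these formulas.\<close>

lemma edge_child_bounds:
  assumes "k < 2^Suc n"
  shows "edge (Suc n) k \<le> 51/100 * edge n (k div 2)" "edge n (k div 2) \<le> 2 * edge (Suc n) k"
    "cos (koch_angle p n (k div 2)) = edge n (k div 2) / (2 * edge (Suc n) k)"
proof -
  let ?i = "k div 2"
  have i: "?i < 2^n" and "k = 2 * ?i \<or> k = Suc (2 * ?i)"
    using half_index[OF assms] by auto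
  then have e: "edge (Suc n) k = dist (p n ?i) (apex n ?i)"
    using edge_children[OF i] by metis
  show "edge (Suc n) k \<le> 51/100 * edge n ?i" "edge n ?i \<le> 2 * edge (Suc n) k"
    using flat[OF i] dist_triangle2[of "p n ?i" "p n (Suc ?i)" "apex n ?i"]
    unfolding e by (simp_all add: edge_def flat_cap_def)
  show "cos (koch_angle p n ?i) = edge n ?i / (2 * edge (Suc n) k)"
    using cos_base_angle[OF is_cap_apex[OF i]] unfolding e by (simp add: koch_angle_eq edge_def)
qed

lemma edge_le: "i < 2^n \<Longrightarrow> edge n i \<le> (51/100)^n * edge 0 0"
proof (induction n arbitrary: i)
  case (Suc n)
  have "edge (Suc n) i \<le> 51/100 * edge n (i div 2)"
    using Suc.prems by (rule edge_child_bounds)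
  also have "\<dots> \<le> 51/100 * ((51/100)^n * edge 0 0)"
    using Suc.IH Suc.prems half_index by (intro mult_left_mono) auto
  finally show ?case
    by simp
qed simp

text \<open>The apex is the common end point of the two sibling segments, so
  \<open>flat_caps_obtuse\<close> applies with the apex as \<open>v\<close>.\<close>

lemma siblings_obtuse:
  assumes "i < 2^n" "x \<in> koch_T p (Suc n) (2 * i)" "y \<in> koch_T p (Suc n) (Suc (2 * i))"
  shows "dist x (apex n i) \<le> dist x y" "dist y (apex n i) \<le> dist x y"
proof -
  have k: "2 * i < 2^Suc n" "Suc (2 * i) < 2^Suc n"
    using assms(1) by auto
  have "(x - apex n i) \<bullet> (y - apex n i) \<le> 0"
    using flat_caps_obtuse[OF flat[OF assms(1)], of "apex (Suc n) (2 * i)" "apex (Suc n) (Suc (2 * i))" x y]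
      flat[OF k(1)] flat[OF k(2)] assms by (simp add: child_vertices[OF assms(1)] koch_T_eq)
  then show "dist x (apex n i) \<le> dist x y" "dist y (apex n i) \<le> dist x y"
    by (rule dist_ge_if_obtuse)+
qed

lemma vertices_in_koch_T: "p n i \<in> koch_T p n i" "p n (Suc i) \<in> koch_T p n i"
  by (simp_all add: koch_T_eq cap_def hull_inc)

lemma koch_A_subset_T: "koch_A p n i \<subseteq> koch_T p n i"
  unfolding koch_A_def using vertices_in_koch_T[of n i]
  by (intro closed_segment_subset) (auto simp: koch_T_eq cap_def convex_convex_hull)

lemma koch_T_dist_le: "i < 2^n \<Longrightarrow> x \<in> koch_T p n i \<Longrightarrow> y \<in> koch_T p n i \<Longrightarrow> dist x y \<le> edge n i"
  using flat_cap_dist_le[OF flat] by (simp add: koch_T_eq edge_def)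

lemma closed_koch_T: "closed (koch_T p n i)"
  by (simp add: koch_T_eq cap_def compact_imp_closed compact_convex_hull finite_imp_compact)

lemma koch_T_antimono:
  assumes "t \<in> nondyadic" "m \<le> n"
  shows "koch_T p n (dyadic_index n t) \<subseteq> koch_T p m (dyadic_index m t)"
  using assms(2)
proof (induction n rule: dec_induct)
  case (step n)
  have "koch_T p (Suc n) (dyadic_index (Suc n) t) \<subseteq> koch_T p n (dyadic_index n t)"
    using koch_child(1)[OF dyadic_index_bounds(3)[OF assms(1)]] dyadic_index_Suc[OF assms(1)] by simp
  then show ?case
    using step.IH by blast
qed simp

section \<open>The limit curve over the parameter interval\<close>

definition base_point :: "real \<Rightarrow> real^2" where
  "base_point t = p 0 0 + t *\<^sub>R (p 0 1 - p 0 0)"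

definition curve :: "real \<Rightarrow> real^2" where
  "curve t = koch_limit p (base_point t)"

lemma koch_F_in_koch_A:
  assumes "t \<in> nondyadic"
  shows "koch_F p n (base_point t) \<in> koch_A p n (dyadic_index n t)"
proof -
  let ?i = "dyadic_index n t"
  have "p 0 0 \<noteq> p 0 1"
    using edge_pos[of 0 0] by (simp add: edge_def)
  moreover have "dist (p 0 0) (base_point t) = t * dist (p 0 0) (p 0 1)"
    using nondyadic_bounds[OF assms] by (simp add: base_point_def dist_norm norm_minus_commute)
  ultimately have "dist (p 0 0) (base_point t) / dist (p 0 0) (p 0 1) = t"
    by simp
  moreover have "min ?i (2^n - 1) = ?i"
    using dyadic_index_bounds(3)[OF assms, of n] by linarith
  ultimately have "koch_F p n (base_point t)
      = p n ?i + (2^n * t - real ?i) *\<^sub>R (p n (Suc ?i) - p n ?i)"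
    by (simp add: koch_F_def Let_def dyadic_index_def)
  then show ?thesis
    unfolding koch_A_def in_segment using dyadic_index_bounds(1,2)[OF assms, of n]
    by (intro exI[of _ "2^n * t - real ?i"]) (auto simp: algebra_simps)
qed

text \<open>The caps over \<open>t\<close> are nested and closed, and by \<open>edge_le\<close> they
  shrink geometrically. So the polygonal points converge, which gives the \<open>lim\<close> in
  \<open>koch_limit\<close> its meaning, and the limit stays in every cap.\<close>

lemma curve_in_koch_T:
  assumes "t \<in> nondyadic"
  shows "curve t \<in> koch_T p n (dyadic_index n t)"
proof -
  let ?F = "\<lambda>n. koch_F p n (base_point t)" and ?T = "\<lambda>n. koch_T p n (dyadic_index n t)"
  have inT: "?F k \<in> ?T n" if "n \<le> k" for n k
    using koch_F_in_koch_A[OF assms] koch_A_subset_T koch_T_antimono[OF assms that] by blast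
  have "Cauchy ?F"
    unfolding Cauchy_altdef2
  proof (intro allI impI)
    fix e :: real assume "e > 0"
    have "(\<lambda>n. (51/100)^n * edge 0 0) \<longlonglongrightarrow> 0"
      by (auto intro!: tendsto_mult_left_zero LIMSEQ_realpow_zero)
    then have "\<forall>\<^sub>F n in sequentially. (51/100)^n * edge 0 0 < e"
      using \<open>e > 0\<close> by (rule order_tendstoD)
    then obtain N where N: "(51/100)^N * edge 0 0 < e"
      by (auto simp: eventually_sequentially)
    have "dist (?F k) (?F N) < e" if "k \<ge> N" for k
      using koch_T_dist_le[OF dyadic_index_bounds(3)[OF assms] inT[OF that] inT[OF order_refl]]
        edge_le[OF dyadic_index_bounds(3)[OF assms, of N]] N by linarith
    then show "\<exists>N. \<forall>n\<ge>N. dist (?F n) (?F N) < e"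
      by blast
  qed
  then have "?F \<longlonglongrightarrow> curve t"
    by (simp add: curve_def koch_limit_def Cauchy_convergent_iff convergent_LIMSEQ_iff)
  moreover have "\<forall>\<^sub>F k in sequentially. ?F k \<in> ?T n"
    using inT by (auto simp: eventually_sequentially)
  ultimately show ?thesis
    by (intro Lim_in_closed_set[OF closed_koch_T, where F = sequentially and f = ?F]) auto
qed

text \<open>Induction on a lower bound for the distance to the division point: the curve point either
  stays in the cap that has the vertex as an end point, or it lies in the sibling of that cap.\<close>

lemma curve_dist_left_vertex:
  assumes t: "t \<in> nondyadic"
  shows "(2^n * t - real (dyadic_index n t)) * edge n (dyadic_index n t)
    \<le> 2 * dist (curve t) (p n (dyadic_index n t))"
proof -
  \<comment> \<open>The position of \<open>t\<close> in its part is positive, as \<open>t\<close> is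
    no division point. Each descent to a left child doubles it, so \<open>k\<close> bounds the
    number of such descents.\<close>
  have "\<exists>k. (1/2)^k < 2^n * t - real (dyadic_index n t)"
    using dyadic_index_bounds(1)[OF t, of n] by (intro real_arch_pow_inv) auto
  then obtain k where "(1/2)^k \<le> 2^n * t - real (dyadic_index n t)"
    using less_imp_le by blast
  then show ?thesis
  proof (induction k arbitrary: n)
    \<comment> \<open>Vacuous: the position is less than 1.\<close>
    case 0
    then show ?case
      using dyadic_index_bounds(2)[OF t, of n] by simp
  next
    case (Suc k)
    let ?i = "dyadic_index n t"
    have i: "?i < 2^n"
      by (rule dyadic_index_bounds[OF t])
    have pos: "0 \<le> 2^n * t - real ?i" "2^n * t - real ?i \<le> 1"
      using dyadic_index_bounds[OF t, of n] by auto
    have child: "edge n ?i \<le> 2 * dist (p n ?i) (apex n ?i)"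
      using edge_child_bounds(2)[of "2 * ?i" n] edge_children[OF i] i by simp
    show ?case
    proof (cases rule: dyadic_index_Suc_cases[OF t, of n])
      \<comment> \<open>The vertex is also the left end of the left child, so the induction
        hypothesis applies there.\<close>
      case 1
      then have "(2 * (2^n * t - real ?i)) * dist (p n ?i) (apex n ?i) \<le> 2 * dist (curve t) (p n ?i)"
        using Suc.IH[of "Suc n"] Suc.prems unfolding 1 edge_children[OF i] child_vertices[OF i]
        by (simp add: algebra_simps)
      moreover have "(2^n * t - real ?i) * edge n ?i \<le> (2^n * t - real ?i) * (2 * dist (p n ?i) (apex n ?i))"
        using pos child by (intro mult_left_mono)
      ultimately show ?thesis
        by linarith
    next
      \<comment> \<open>\<open>t\<close> has passed the apex, so the distance to the vertex is at
        least one leg, which is at least half the base.\<close>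
      case 2
      have "p n ?i \<in> koch_T p (Suc n) (2 * ?i)"
        using vertices_in_koch_T(1)[of "Suc n" "2 * ?i"] by (simp add: child_vertices[OF i])
      moreover have "curve t \<in> koch_T p (Suc n) (Suc (2 * ?i))"
        using curve_in_koch_T[OF t, of "Suc n"] 2 by simp
      ultimately have "dist (p n ?i) (apex n ?i) \<le> dist (curve t) (p n ?i)"
        using siblings_obtuse(1)[OF i] by (metis dist_commute)
      moreover have "(2^n * t - real ?i) * edge n ?i \<le> 1 * edge n ?i"
        using pos edge_pos[OF i] by (intro mult_right_mono) auto
      ultimately show ?thesis
        using child by linarith
    qed
  qed
qed

text \<open>Mirror image of \<open>curve_dist_left_vertex\<close>: now the right child keeps the
  vertex, and the left child is the far one.\<close>

lemma curve_dist_right_vertex: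
  assumes t: "t \<in> nondyadic"
  shows "(real (dyadic_index n t) + 1 - 2^n * t) * edge n (dyadic_index n t)
    \<le> 2 * dist (curve t) (p n (Suc (dyadic_index n t)))"
proof -
  have "\<exists>k. (1/2)^k < real (dyadic_index n t) + 1 - 2^n * t"
    using dyadic_index_bounds(2)[OF t, of n] by (intro real_arch_pow_inv) auto
  then obtain k where "(1/2)^k \<le> real (dyadic_index n t) + 1 - 2^n * t"
    using less_imp_le by blast
  then show ?thesis
  proof (induction k arbitrary: n)
    case 0
    then show ?case
      using dyadic_index_bounds(1)[OF t, of n] by simp
  next
    case (Suc k)
    let ?i = "dyadic_index n t"
    have i: "?i < 2^n"
      by (rule dyadic_index_bounds[OF t])
    have pos: "0 \<le> real ?i + 1 - 2^n * t" "real ?i + 1 - 2^n * t \<le> 1"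
      using dyadic_index_bounds[OF t, of n] by auto
    have child: "edge n ?i \<le> 2 * dist (p n ?i) (apex n ?i)"
      using edge_child_bounds(2)[of "2 * ?i" n] edge_children[OF i] i by simp
    show ?case
    proof (cases rule: dyadic_index_Suc_cases[OF t, of n])
      case 2
      then have "(2 * (real ?i + 1 - 2^n * t)) * dist (p n ?i) (apex n ?i) \<le> 2 * dist (curve t) (p n (Suc ?i))"
        using Suc.IH[of "Suc n"] Suc.prems unfolding 2 Suc_eq_plus1[symmetric] edge_children[OF i] child_vertices[OF i]
        by (simp add: algebra_simps)
      moreover have "(real ?i + 1 - 2^n * t) * edge n ?i \<le> (real ?i + 1 - 2^n * t) * (2 * dist (p n ?i) (apex n ?i))"
        using pos child by (intro mult_left_mono)
      ultimately show ?thesis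
        by linarith
    next
      case 1
      have "p n (Suc ?i) \<in> koch_T p (Suc n) (Suc (2 * ?i))"
        using vertices_in_koch_T(2)[of "Suc n" "Suc (2 * ?i)"] by (simp add: child_vertices[OF i])
      moreover have "curve t \<in> koch_T p (Suc n) (2 * ?i)"
        using curve_in_koch_T[OF t, of "Suc n"] 1 by simp
      ultimately have "dist (p n (Suc ?i)) (apex n ?i) \<le> dist (curve t) (p n (Suc ?i))"
        using siblings_obtuse(2)[OF i] by blast
      then have "dist (p n ?i) (apex n ?i) \<le> dist (curve t) (p n (Suc ?i))"
        using flat[OF i] by (simp add: flat_cap_def)
      moreover have "(real ?i + 1 - 2^n * t) * edge n ?i \<le> 1 * edge n ?i"
        using pos edge_pos[OF i] by (intro mult_right_mono) auto
      ultimately show ?thesis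
        using child by linarith
    qed
  qed
qed

text \<open>The length of the segment over \<open>t\<close> divided by the length
  \<open>1 / 2^n\<close> of its parameter interval. By \<open>cos_koch_angle\<close> and
  \<open>stretch_0\<close> it is \<open>edge 0 0\<close> times the product of the first
  \<open>n\<close> inverse cosines along \<open>t\<close>.\<close>

definition stretch :: "nat \<Rightarrow> real \<Rightarrow> real" where
  "stretch n t = 2^n * edge n (dyadic_index n t)"

text \<open>The points lie in sibling caps on different sides of the apex. The vertex estimates from
  both sides add up to \<open>2^Suc n * (t - s)\<close> times the leg, which is at least
  \<open>(t - s) * stretch n t\<close>; neither distance to the apex exceeds that of the two points,
  and each counts twice.\<close>

lemma curve_expanding_step:
  assumes s: "s \<in> nondyadic" and t: "t \<in> nondyadic" and "s < t"
    and eq: "dyadic_index n s = dyadic_index n t" and ne: "dyadic_index (Suc n) s \<noteq> dyadic_index (Suc n) t"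
  shows "(t - s) * stretch n t \<le> 4 * dist (curve s) (curve t)"
proof -
  let ?i = "dyadic_index n t" and ?l = "dist (p n (dyadic_index n t)) (apex n (dyadic_index n t))"
  have i: "?i < 2^n"
    by (rule dyadic_index_bounds[OF t])
  have "2 ^ Suc n * s < 2 ^ Suc n * t"
    using \<open>s < t\<close> by simp
  then have si: "dyadic_index (Suc n) s = 2 * ?i" and ti: "dyadic_index (Suc n) t = Suc (2 * ?i)"
    using ne eq dyadic_index_bounds[OF s, of "Suc n"] dyadic_index_bounds[OF t, of "Suc n"]
      dyadic_index_Suc[OF s, of n] dyadic_index_Suc[OF t, of n] by linarith+
  have "(real (2 * ?i) + 1 - 2^Suc n * s) * ?l \<le> 2 * dist (curve s) (apex n ?i)"
    using curve_dist_right_vertex[OF s, of "Suc n"]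
    unfolding si edge_children[OF i] child_vertices[OF i] .
  moreover have "(2^Suc n * t - real (Suc (2 * ?i))) * ?l \<le> 2 * dist (curve t) (apex n ?i)"
    using curve_dist_left_vertex[OF t, of "Suc n"]
    unfolding ti edge_children[OF i] child_vertices[OF i] .
  moreover have "dist (curve s) (apex n ?i) \<le> dist (curve s) (curve t)"
      "dist (curve t) (apex n ?i) \<le> dist (curve s) (curve t)"
    using siblings_obtuse[OF i] curve_in_koch_T[OF s, of "Suc n"] curve_in_koch_T[OF t, of "Suc n"]
    by (auto simp: si ti)
  moreover have "(t - s) * stretch n t \<le> (t - s) * (2^Suc n * ?l)"
    using edge_child_bounds(2)[of "2 * ?i" n] edge_children[OF i] i \<open>s < t\<close>
    by (auto simp: stretch_def intro!: mult_left_mono)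
  ultimately show ?thesis
    by (simp add: algebra_simps)
qed

lemma cos_koch_angle:
  assumes "t \<in> nondyadic"
  shows "cos (koch_angle p n (dyadic_index n t)) = stretch n t / stretch (Suc n) t"
    "stretch n t \<le> stretch (Suc n) t" "0 < stretch n t"
proof -
  have "dyadic_index (Suc n) t < 2^Suc n" "dyadic_index n t < 2^n"
    by (rule dyadic_index_bounds[OF assms])+
  then show "cos (koch_angle p n (dyadic_index n t)) = stretch n t / stretch (Suc n) t"
    "stretch n t \<le> stretch (Suc n) t" "0 < stretch n t"
    using edge_child_bounds(2,3)[of "dyadic_index (Suc n) t" n] edge_pos[of "dyadic_index n t" n]
    by (simp_all add: stretch_def dyadic_index_Suc[OF assms])
qed

lemma stretch_mono: "t \<in> nondyadic \<Longrightarrow> m \<le> n \<Longrightarrow> stretch m t \<le> stretch n t"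
  by (rule lift_Suc_mono_le) (rule cos_koch_angle)

text \<open>\<open>curve_expanding_step\<close> is used at the generation where the parameters part,
  and the factors do not decrease up to there. With \<open>m = 0\<close> the inverse is Lipschitz; a
  larger \<open>m\<close> improves the constant near \<open>t\<close> to
  \<open>4 / stretch m t\<close>.\<close>

lemma curve_expanding:
  assumes s: "s \<in> nondyadic" and t: "t \<in> nondyadic" and eq: "dyadic_index m s = dyadic_index m t"
  shows "\<bar>s - t\<bar> * stretch m t \<le> 4 * dist (curve s) (curve t)"
proof (cases "s = t")
  case False
  then obtain n where n: "m \<le> n" "dyadic_index n s = dyadic_index n t"
      "dyadic_index (Suc n) s \<noteq> dyadic_index (Suc n) t"
    using dyadic_index_separates[OF s t] eq by blast
  have "\<bar>s - t\<bar> * stretch m t \<le> \<bar>s - t\<bar> * stretch n t"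
    by (intro mult_left_mono stretch_mono t n) auto
  also have "\<dots> \<le> 4 * dist (curve s) (curve t)"
  proof (cases "s < t")
    case True
    then show ?thesis
      using curve_expanding_step[OF s t True n(2,3)] by simp
  next
    case False
    then have "t < s"
      using \<open>s \<noteq> t\<close> by simp
    moreover have "stretch n s = stretch n t"
      by (simp add: stretch_def n)
    ultimately show ?thesis
      using curve_expanding_step[OF t s _ n(2)[symmetric] n(3)[symmetric]] by (simp add: dist_commute)
  qed
  finally show ?thesis .
qed simp

lemma stretch_0: "t \<in> nondyadic \<Longrightarrow> stretch 0 t = edge 0 0"
  by (simp add: stretch_def dyadic_index_0)

lemma curve_expanding_0:
  assumes "s \<in> nondyadic" "t \<in> nondyadic"
  shows "\<bar>s - t\<bar> * edge 0 0 \<le> 4 * dist (curve s) (curve t)"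
  using curve_expanding[OF assms, of 0] by (simp add: assms dyadic_index_0 stretch_0)

section \<open>Injectivity and the caps through a curve point\<close>

lemma inj_on_curve: "inj_on curve nondyadic"
proof (rule inj_onI)
  fix s t assume "s \<in> nondyadic" "t \<in> nondyadic" "curve s = curve t"
  then show "s = t"
    using curve_expanding_0[of s t] edge_pos[of 0 0] by (simp add: mult_le_0_iff)
qed

text \<open>Sibling caps meet only in their apex, by \<open>siblings_obtuse\<close> with both points
  equal, and the vertex estimates keep the curve point away from it. Induction handles caps with
  different parents.\<close>

lemma curve_koch_T_unique:
  assumes t: "t \<in> nondyadic"
  shows "j < 2^n \<Longrightarrow> curve t \<in> koch_T p n j \<Longrightarrow> j = dyadic_index n t"
proof (induction n arbitrary: j)
  case 0
  then show ?case
    by (simp add: dyadic_index_0 t)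
next
  case (Suc n)
  let ?i = "dyadic_index n t"
  have i: "?i < 2^n"
    by (rule dyadic_index_bounds[OF t])
  have "curve t \<in> koch_T p n (j div 2)"
    using koch_child(1)[OF Suc.prems(1)] Suc.prems(2) by blast
  then have j: "j div 2 = ?i"
    using Suc.IH half_index[OF Suc.prems(1)] by blast
  show ?case
  proof (rule ccontr)
    assume "j \<noteq> dyadic_index (Suc n) t"
    then consider "j = 2 * ?i" "dyadic_index (Suc n) t = Suc (2 * ?i)"
      | "dyadic_index (Suc n) t = 2 * ?i" "j = Suc (2 * ?i)"
      using j dyadic_index_Suc[OF t, of n] by linarith
    then show False
    proof cases
      case 1
      then have "curve t = apex n ?i"
        using siblings_obtuse(1)[OF i, of "curve t" "curve t"] Suc.prems(2) curve_in_koch_T[OF t, of "Suc n"] by simp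
      moreover have "0 < (2^Suc n * t - real (dyadic_index (Suc n) t)) * edge (Suc n) (dyadic_index (Suc n) t)"
        using dyadic_index_bounds[OF t, of "Suc n"] by (intro mult_pos_pos edge_pos) auto
      ultimately show False
        using curve_dist_left_vertex[OF t, of "Suc n"] by (simp add: 1 child_vertices[OF i])
    next
      case 2
      then have "curve t = apex n ?i"
        using siblings_obtuse(1)[OF i, of "curve t" "curve t"] Suc.prems(2) curve_in_koch_T[OF t, of "Suc n"] by simp
      moreover have "0 < (real (dyadic_index (Suc n) t) + 1 - 2^Suc n * t) * edge (Suc n) (dyadic_index (Suc n) t)"
        using dyadic_index_bounds[OF t, of "Suc n"] by (intro mult_pos_pos edge_pos) auto
      ultimately show False
        using curve_dist_right_vertex[OF t, of "Suc n"] by (simp add: 2 child_vertices[OF i])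
    qed
  qed
qed

text \<open>The \<open>Max\<close> in \<open>koch_index\<close> is over a singleton, so
  \<open>koch_Pi\<close> at \<open>curve t\<close> follows the parts that contain
  \<open>t\<close>.\<close>

lemma koch_index_curve:
  assumes "t \<in> nondyadic"
  shows "koch_index p n (curve t) = dyadic_index n t"
proof -
  have "{i. i < 2^n \<and> curve t \<in> koch_T p n i} = {dyadic_index n t}"
    using curve_koch_T_unique[OF assms] curve_in_koch_T[OF assms] dyadic_index_bounds(3)[OF assms] by blast
  then show ?thesis
    by (simp add: koch_index_def)
qed

lemma stretch_unbounded:
  assumes t: "t \<in> nondyadic" and Pi: "koch_Pi p (curve t) = \<infinity>"
  shows "\<exists>n. K < stretch n t"
proof -
  define c where "c i = stretch (Suc i) t / stretch i t" for i
  have "c i \<ge> 1" for i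
    using cos_koch_angle(2,3)[OF t, of i] by (simp add: c_def)
  moreover have "(\<Prod>i. ennreal (c i)) = \<infinity>"
    using Pi by (simp add: koch_Pi_def koch_index_curve[OF t] cos_koch_angle(1)[OF t] c_def)
  \<comment> \<open>The divisor \<open>edge 0 0\<close> is \<open>stretch 0 t\<close>, the
    denominator that remains after telescoping.\<close>
  ultimately obtain n where n: "K / edge 0 0 < (\<Prod>i\<le>n. c i)"
    using prodinf_ennreal_infinity_unbounded by blast
  have "(\<Prod>i\<le>n. c i) = stretch (Suc n) t / stretch 0 t"
  proof (induction n)
    case (Suc n)
    then show ?case
      using cos_koch_angle(3)[OF t, of "Suc n"] by (simp add: c_def)
  qed (simp add: c_def)
  then have "K < stretch (Suc n) t"
    using n edge_pos[of 0 0] by (simp add: stretch_0[OF t] field_simps)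
  then show ?thesis
    by blast
qed

section \<open>Null preimages under the curve\<close>

lemma null_preimage_null:
  assumes "hausdorff1 M = 0"
  shows "hausdorff1 {t \<in> nondyadic. curve t \<in> M} = 0"
proof -
  let ?h = "inv_into nondyadic curve"
  have "hausdorff1 (M \<inter> curve ` nondyadic) = 0"
    using assms by (rule hausdorff1_null_subset) blast
  \<comment> \<open>This is \<open>curve_expanding_0\<close> read as a statement on the inverse; the
    preimage of \<open>M\<close> is then a Lipschitz image of a null set.\<close>
  moreover have "(4 / edge 0 0)-lipschitz_on (M \<inter> curve ` nondyadic) ?h"
  proof (rule lipschitz_onI)
    fix x y assume "x \<in> M \<inter> curve ` nondyadic" "y \<in> M \<inter> curve ` nondyadic"
    then obtain s t where "s \<in> nondyadic" "t \<in> nondyadic" "x = curve s" "y = curve t"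
      by blast
    then show "dist (?h x) (?h y) \<le> 4 / edge 0 0 * dist x y"
      using curve_expanding_0[of s t] edge_pos[of 0 0] inj_on_curve
      by (simp add: dist_real_def field_simps)
  qed (use edge_pos[of 0 0] in simp)
  ultimately have "hausdorff1 (?h ` (M \<inter> curve ` nondyadic)) = 0"
    by (rule hausdorff1_null_lipschitz_image)
  then show ?thesis
  proof (rule hausdorff1_null_subset)
    show "{t \<in> nondyadic. curve t \<in> M} \<subseteq> ?h ` (M \<inter> curve ` nondyadic)"
    proof
      fix t assume "t \<in> {t \<in> nondyadic. curve t \<in> M}"
      then have "t = ?h (curve t)" "curve t \<in> M \<inter> curve ` nondyadic"
        using inj_on_curve by auto
      then show "t \<in> ?h ` (M \<inter> curve ` nondyadic)"
        by blast
    qed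
  qed
qed

text \<open>Where the stretching factors are unbounded, the inverse of the curve has derivative zero along
  any Lipschitz curve, so that an easy case of Sard's theorem applies.\<close>

lemma lipschitz_preimage_null:
  fixes \<gamma> :: "real \<Rightarrow> real^2"
  assumes \<gamma>: "L-lipschitz_on UNIV \<gamma>"
  shows "hausdorff1 {t \<in> nondyadic. koch_Pi p (curve t) = \<infinity> \<and> curve t \<in> range \<gamma>} = 0"
proof -
  define S where "S = {t \<in> nondyadic. koch_Pi p (curve t) = \<infinity>}"
  define E where "E = {u. \<gamma> u \<in> curve ` S}"
  define g where "g u = inv_into nondyadic curve (\<gamma> u)" for u
  have g: "g u \<in> S" "curve (g u) = \<gamma> u" if "u \<in> E" for u
    using that inj_on_curve by (auto simp: E_def S_def g_def)
  \<comment> \<open>The derivative is taken within \<open>E\<close>, since off \<open>E\<close> the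
    point \<open>\<gamma> u\<close> may leave the curve, where \<open>inv_into\<close> is
    arbitrary.\<close>
  have "(g has_derivative (\<lambda>_. 0)) (at u within E)" if u: "u \<in> E" for u
    unfolding has_derivative_within_alt
  proof (intro conjI allI impI)
    fix e :: real assume e: "e > 0"
    have L: "L \<ge> 0"
      using \<gamma> by (rule lipschitz_on_nonneg)
    let ?t = "g u"
    have t: "?t \<in> nondyadic" "koch_Pi p (curve ?t) = \<infinity>"
      using g[OF u] by (auto simp: S_def)
    \<comment> \<open>Once \<open>g v\<close> and \<open>g u\<close> share the part of generation
      \<open>m\<close>, the local Lipschitz constant \<open>4 * L / stretch m ?t\<close> is below
      \<open>e\<close>.\<close>
    obtain m where m: "4 * L / e < stretch m ?t"
      using stretch_unbounded[OF t] by blast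
    obtain r where r: "r > 0" "\<And>s. s \<in> nondyadic \<Longrightarrow> \<bar>s - ?t\<bar> < r \<Longrightarrow> dyadic_index m s = dyadic_index m ?t"
      using dyadic_index_locally_constant[OF t(1)] by metis
    \<comment> \<open>The global bound \<open>curve_expanding_0\<close> turns
      \<open>\<bar>v - u\<bar> < d\<close> into \<open>\<bar>g v - g u\<bar> < r\<close>;
      \<open>L + 1\<close> keeps the denominator positive.\<close>
    define d where "d = r * edge 0 0 / (4 * (L + 1))"
    have "d > 0"
      using r(1) L edge_pos[of 0 0] by (simp add: d_def)
    moreover have "norm (g v - g u - 0) \<le> e * norm (v - u)" if v: "v \<in> E" "norm (v - u) < d" for v
    proof -
      have s: "g v \<in> nondyadic"
        using g[OF v(1)] by (simp add: S_def)
      have *: "4 * dist (curve (g v)) (curve ?t) \<le> 4 * L * \<bar>v - u\<bar>"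
        using lipschitz_onD[OF \<gamma>, of v u] g u v by (simp add: dist_real_def)
      have "\<bar>g v - ?t\<bar> * edge 0 0 \<le> 4 * L * \<bar>v - u\<bar>"
        using curve_expanding_0[OF s t(1)] * by linarith
      also have "\<dots> \<le> 4 * (L + 1) * \<bar>v - u\<bar>"
        by (simp add: mult_right_mono)
      also have "\<dots> < 4 * (L + 1) * d"
        using v(2) L by (intro mult_strict_left_mono) auto
      also have "\<dots> = r * edge 0 0"
        using L by (simp add: d_def)
      finally have "\<bar>g v - ?t\<bar> < r"
        using edge_pos[of 0 0] by simp
      then have "\<bar>g v - ?t\<bar> * stretch m ?t \<le> 4 * L * \<bar>v - u\<bar>"
        using curve_expanding[OF s t(1) r(2)[OF s]] * by linarith
      also have "\<dots> \<le> (e * stretch m ?t) * \<bar>v - u\<bar>"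
        using m e by (intro mult_right_mono) (auto simp: field_simps)
      finally show ?thesis
        using cos_koch_angle(3)[OF t(1), of m] by (simp add: mult.assoc mult.commute[of "stretch m ?t"])
    qed
    ultimately show "\<exists>d>0. \<forall>y\<in>E. norm (y - u) < d \<longrightarrow> norm (g y - g u - 0) \<le> e * norm (y - u)"
      by blast
  qed simp
  then have "hausdorff1 (g ` E) = 0"
    by (rule hausdorff1_null_zero_derivative_image)
  then show ?thesis
  proof (rule hausdorff1_null_subset)
    show "{t \<in> nondyadic. koch_Pi p (curve t) = \<infinity> \<and> curve t \<in> range \<gamma>} \<subseteq> g ` E"
    proof
      fix t assume t: "t \<in> {t \<in> nondyadic. koch_Pi p (curve t) = \<infinity> \<and> curve t \<in> range \<gamma>}"
      then obtain u where "curve t = \<gamma> u"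
        by blast
      moreover from this have "g u = t"
        using t inj_on_curve by (simp add: g_def flip: \<open>curve t = \<gamma> u\<close>)
      moreover have "u \<in> E"
        using t \<open>curve t = \<gamma> u\<close> by (auto simp: E_def S_def intro: rev_image_eqI)
      ultimately show "t \<in> g ` E"
        by blast
    qed
  qed
qed

end

theorem theorem8p4:
  fixes p :: koch_vertices and A :: "(real^2) set"
  assumes "koch_type_set p A"
    and "hausdorff1 (Lambda_inf_inv p A) > 0"
  shows "\<not> countably_1_rectifiable A"
proof
  interpret koch p
    using assms(1) by unfold_locales (simp add: koch_type_set_def)
  assume "countably_1_rectifiable A"
  then obtain M0 and F :: "nat \<Rightarrow> real \<Rightarrow> real^2" where A: "A \<subseteq> M0 \<union> (\<Union>j. range (F j))"
      and M0: "hausdorff1 M0 = 0" and F: "\<And>j. \<exists>L. L-lipschitz_on UNIV (F j)"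
    unfolding countably_1_rectifiable_def by blast
  define D where "D = (\<lambda>(n, i). real i / 2^n) ` (UNIV :: (nat \<times> nat) set)"
  define P where "P j = {t \<in> nondyadic. koch_Pi p (curve t) = \<infinity> \<and> curve t \<in> range (F j)}" for j
  \<comment> \<open>Parameters that cover the preimage of \<open>Lambda_inf p A\<close>: division
    points, those mapped into \<open>M0\<close>, and for each Lipschitz curve those of infinite
    product mapped into its range.\<close>
  let ?Z = "D \<union> ({t \<in> nondyadic. curve t \<in> M0} \<union> (\<Union>j. P j))"
  have "hausdorff1 (P j) = 0" for j
    unfolding P_def using F[of j] lipschitz_preimage_null by blast
  moreover have "hausdorff1 D = 0"
    unfolding D_def by (intro hausdorff1_null_countable countable_image) simp
  ultimately have "hausdorff1 ?Z = 0"
    by (intro hausdorff1_null_Un hausdorff1_null_UN null_preimage_null M0)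
  \<comment> \<open>\<open>base_point\<close> carries the null set from the line to the initial
    segment, where \<open>Lambda_inf_inv\<close> lives.\<close>
  moreover have "(edge 0 0)-lipschitz_on ?Z base_point"
    by (rule lipschitz_onI)
      (simp_all add: base_point_def edge_def dist_norm norm_minus_commute flip: scaleR_left_diff_distrib)
  ultimately have "hausdorff1 (base_point ` ?Z) = 0"
    by (rule hausdorff1_null_lipschitz_image)
  moreover have "Lambda_inf_inv p A \<subseteq> base_point ` ?Z"
  proof
    fix x assume x: "x \<in> Lambda_inf_inv p A"
    then have "x \<in> closed_segment (p 0 0) (p 0 1)"
      by (simp add: Lambda_inf_inv_def koch_A_def)
    then obtain t where t: "0 \<le> t" "t \<le> 1" "x = base_point t"
      by (auto simp: closed_segment_def base_point_def algebra_simps)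
    have "t \<in> ?Z"
    proof (cases "t \<in> nondyadic")
      case False
      then show ?thesis
        using t by (simp add: nondyadic_def D_def)
    next
      case True
      have "curve t \<in> A" "koch_Pi p (curve t) = \<infinity>"
        using x by (auto simp: Lambda_inf_inv_def Lambda_inf_def curve_def t(3))
      then show ?thesis
        using A True by (auto simp: P_def)
    qed
    then show "x \<in> base_point ` ?Z"
      using t(3) by blast
  qed
  ultimately have "hausdorff1 (Lambda_inf_inv p A) = 0"
    by (rule hausdorff1_null_subset)
  then show False
    using assms(2) by simp
qed

end
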